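(* Let $(M^n,g)$ be a complete Riemannian spin manifold without boundary and let $f\in C^\infty(M)$. The weighted Ricci curvature $\mathrm{Ric}_f=\mathrm{Ric}+\mathrm{Hess}_f$ is proportional to the commutator of $D_f$ and $\nabla$: for any vector field $X$ and spinor $\psi$, $$[D_f,\nabla_X]\psi=\frac12\,\mathrm{Ric}_f(X)\cdot\psi .$$
   Context: $\Sigma M\to M$ is the complex spinor bundle with its Hermitian metric, Clifford multiplication $\cdot$ (convention $X\cdot Y\cdot\psi+Y\cdot X\cdot\psi=-2g(X,Y)\psi$), and spin connection $\nabla$ induced by the Levi-Civita connection. A spinor is a section of $\Sigma M$. In a local orthonormal frame the Dirac operator is $D=\sum_i e_i\cdot\nabla_{e_i}$; the weighted Dirac operator is $D_f\psi=D\psi-\frac12(\nabla f)\cdot\psi$. The commutator is $[D_f,\nabla_X]\psi=D_f\nabla_X\psi-\nabla_XD_f\psi$. $\mathrm{Ric}$ is the Ricci curvature of $g$ and $\mathrm{Hess}_f$ is the Hessian of $f$; the symmetric 2-tensor $\mathrm{Ric}_f$ is regarded as an endomorphism of $TM$ via $g$, so that $\mathrm{Ric}_f(X)$ is a vector field acting on spinors by Clifford multiplication.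
   Formalization: The identity fails for the literal commutator when X is not parallel; it is proved for every X with D_f∇_Xψ read as (D_f(∇ψ))(X), D_f acting on spinor-valued 1-forms by the product connection, and for the literal commutator at points where ∇X = 0. *)

theory Defs
  imports "HOL-Analysis.Analysis"
begin

section \<open>Smooth maps between normed spaces\<close>

primrec Ck_on :: "nat \<Rightarrow> 'a::real_normed_vector set \<Rightarrow> ('a \<Rightarrow> 'b::real_normed_vector) \<Rightarrow> bool" where
  "Ck_on 0 S F \<longleftrightarrow> continuous_on S F"
| "Ck_on (Suc k) S F \<longleftrightarrow> (\<forall>x\<in>S. F differentiable at x)
     \<and> (\<forall>v. Ck_on k S (\<lambda>x. frechet_derivative F (at x) v))"

text \<open>Only used for open sets.\<close>

definition smooth_on :: "'a::real_normed_vector set \<Rightarrow> ('a \<Rightarrow> 'b::real_normed_vector) \<Rightarrow> bool" where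
  "smooth_on S F \<longleftrightarrow> (\<forall>k. Ck_on k S F)"


section \<open>Riemannian manifolds\<close>

text \<open>
  The manifold is the whole type \<open>'m\<close>, of dimension \<open>CARD('n)\<close>, presented by an atlas indexed by
  \<open>'c\<close>; \<open>gram M c p\<close> is the matrix of the metric at \<open>p\<close> in the coordinates of chart \<open>c\<close>.
  Tensor fields are given by their components: a vector field \<open>X\<close> assigns to every chart \<open>c\<close> the
  component function \<open>X c\<close>, and these are related on overlaps by the derivative of the
  change of coordinates. Values \<open>X c p\<close> with \<open>p\<close> outside the domain of \<open>c\<close> are irrelevant.
\<close>

record ('c, 'm, 'n::finite) riemannian =
  cdom :: "'c \<Rightarrow> 'm set"
  coord :: "'c \<Rightarrow> 'm \<Rightarrow> real ^ 'n"
  gram :: "'c \<Rightarrow> 'm \<Rightarrow> real ^ 'n ^ 'n"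

definition in_chart ::
    "('c, 'm, 'n::finite, 'z) riemannian_scheme \<Rightarrow> 'c \<Rightarrow> ('m \<Rightarrow> 'b) \<Rightarrow> real ^ 'n \<Rightarrow> 'b" where
  "in_chart M c F = F \<circ> inv_into (cdom M c) (coord M c)"

definition smooth_in ::
    "('c, 'm, 'n::finite, 'z) riemannian_scheme \<Rightarrow> 'c \<Rightarrow> 'm set \<Rightarrow> ('m \<Rightarrow> 'b::real_normed_vector) \<Rightarrow> bool" where
  "smooth_in M c U F \<longleftrightarrow> smooth_on (coord M c ` U) (in_chart M c F)"

text \<open>Directional derivative at \<open>p\<close> of \<open>F\<close> along the tangent vector with components \<open>v\<close> in chart \<open>c\<close>.
  In particular \<open>dird M c v (coord M d) p\<close> are the components of that vector in chart \<open>d\<close>.\<close>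

definition dird ::
    "('c, 'm, 'n::finite, 'z) riemannian_scheme \<Rightarrow> 'c \<Rightarrow> real ^ 'n \<Rightarrow> ('m \<Rightarrow> 'b::real_normed_vector) \<Rightarrow> 'm \<Rightarrow> 'b" where
  "dird M c v F p = frechet_derivative (in_chart M c F) (at (coord M c p)) v"

definition smooth_atlas ::
    "('c, 'm::{t2_space, second_countable_topology}, 'n::finite, 'z) riemannian_scheme \<Rightarrow> bool" where
  "smooth_atlas M \<longleftrightarrow>
     (\<Union>c. cdom M c) = UNIV
   \<and> (\<forall>c. open (cdom M c) \<and> open (coord M c ` cdom M c)
        \<and> homeomorphism (cdom M c) (coord M c ` cdom M c) (coord M c) (inv_into (cdom M c) (coord M c)))
   \<and> (\<forall>c d. smooth_in M c (cdom M c \<inter> cdom M d) (coord M d))"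

definition ip ::
    "('c, 'm, 'n::finite, 'z) riemannian_scheme \<Rightarrow> 'c \<Rightarrow> 'm \<Rightarrow> real ^ 'n \<Rightarrow> real ^ 'n \<Rightarrow> real" where
  "ip M c p v w = v \<bullet> (gram M c p *v w)"

definition riemannian_metric ::
    "('c, 'm::topological_space, 'n::finite, 'z) riemannian_scheme \<Rightarrow> bool" where
  "riemannian_metric M \<longleftrightarrow>
     (\<forall>c. smooth_in M c (cdom M c) (gram M c))
   \<and> (\<forall>c. \<forall>p\<in>cdom M c. (\<forall>v w. ip M c p v w = ip M c p w v) \<and> (\<forall>v. v \<noteq> 0 \<longrightarrow> ip M c p v v > 0))
   \<and> (\<forall>c d. \<forall>p\<in>cdom M c \<inter> cdom M d. \<forall>v w.
        ip M d p (dird M c v (coord M d) p) (dird M c w (coord M d) p) = ip M c p v w)"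

definition smooth_function ::
    "('c, 'm, 'n::finite, 'z) riemannian_scheme \<Rightarrow> ('m \<Rightarrow> real) \<Rightarrow> bool" where
  "smooth_function M f \<longleftrightarrow> (\<forall>c. smooth_in M c (cdom M c) f)"

definition vector_field ::
    "('c, 'm, 'n::finite, 'z) riemannian_scheme \<Rightarrow> ('c \<Rightarrow> 'm \<Rightarrow> real ^ 'n) \<Rightarrow> bool" where
  "vector_field M X \<longleftrightarrow>
     (\<forall>c. smooth_in M c (cdom M c) (X c))
   \<and> (\<forall>c d. \<forall>p\<in>cdom M c \<inter> cdom M d. X d p = dird M c (X c p) (coord M d) p)"


subsection \<open>Distance and completeness\<close>

definition pw_C1_curve ::
    "('c, 'm::topological_space, 'n::finite, 'z) riemannian_scheme \<Rightarrow> (real \<Rightarrow> 'm) \<Rightarrow> bool" where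
  "pw_C1_curve M \<gamma> \<longleftrightarrow> continuous_on {0..1} \<gamma>
   \<and> (\<forall>c u v. 0 \<le> u \<and> u < v \<and> v \<le> 1 \<and> \<gamma> ` {u..v} \<subseteq> cdom M c
        \<longrightarrow> (coord M c \<circ> \<gamma>) piecewise_C1_differentiable_on {u..v})"

text \<open>The speed does not depend on the chart that is chosen around \<open>\<gamma> t\<close>.\<close>

definition speed ::
    "('c, 'm, 'n::finite, 'z) riemannian_scheme \<Rightarrow> (real \<Rightarrow> 'm) \<Rightarrow> real \<Rightarrow> real" where
  "speed M \<gamma> t =
     (let c = (SOME c. \<gamma> t \<in> cdom M c); v = vector_derivative (coord M c \<circ> \<gamma>) (at t)
      in sqrt (ip M c (\<gamma> t) v v))"

definition curve_length ::
    "('c, 'm, 'n::finite, 'z) riemannian_scheme \<Rightarrow> (real \<Rightarrow> 'm) \<Rightarrow> ennreal" where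
  "curve_length M \<gamma> = (\<integral>\<^sup>+t\<in>{0..1}. ennreal (speed M \<gamma> t) \<partial>lborel)"

text \<open>The distance of points in different connected components is \<open>\<infinity>\<close>.\<close>

definition riem_dist ::
    "('c, 'm::topological_space, 'n::finite, 'z) riemannian_scheme \<Rightarrow> 'm \<Rightarrow> 'm \<Rightarrow> ennreal" where
  "riem_dist M p q = (INF \<gamma>\<in>{\<gamma>. pw_C1_curve M \<gamma> \<and> \<gamma> 0 = p \<and> \<gamma> 1 = q}. curve_length M \<gamma>)"

definition riem_complete ::
    "('c, 'm::topological_space, 'n::finite, 'z) riemannian_scheme \<Rightarrow> bool" where
  "riem_complete M \<longleftrightarrow>
     (\<forall>s :: nat \<Rightarrow> 'm. (\<forall>e>0. \<exists>N. \<forall>i\<ge>N. \<forall>j\<ge>N. riem_dist M (s i) (s j) < e)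
        \<longrightarrow> (\<exists>p. (\<lambda>i. riem_dist M (s i) p) \<longlonglongrightarrow> 0))"


subsection \<open>Levi-Civita connection, curvature, gradient and Hessian\<close>

text \<open>
  The operators below are local: they take a chart \<open>c\<close> and vector fields on its domain, given by
  their components in \<open>c\<close>. For a global vector field \<open>X\<close> they are applied to \<open>X c\<close>.
\<close>

definition coord_field :: "'n::finite \<Rightarrow> 'm \<Rightarrow> real ^ 'n" where
  "coord_field i = (\<lambda>p. axis i 1)"

definition christoffel ::
    "('c, 'm, 'n::finite, 'z) riemannian_scheme \<Rightarrow> 'c \<Rightarrow> 'n \<Rightarrow> 'n \<Rightarrow> 'n \<Rightarrow> 'm \<Rightarrow> real" where
  "christoffel M c k i j p =
     (\<Sum>l\<in>UNIV. matrix_inv (gram M c p) $ k $ l *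
        (dird M c (axis i 1) (\<lambda>q. gram M c q $ j $ l) p
         + dird M c (axis j 1) (\<lambda>q. gram M c q $ i $ l) p
         - dird M c (axis l 1) (\<lambda>q. gram M c q $ i $ j) p)) / 2"

definition nabla ::
    "('c, 'm, 'n::finite, 'z) riemannian_scheme \<Rightarrow> 'c \<Rightarrow> ('m \<Rightarrow> real ^ 'n) \<Rightarrow> ('m \<Rightarrow> real ^ 'n) \<Rightarrow> 'm \<Rightarrow> real ^ 'n" where
  "nabla M c X Y p = dird M c (X p) Y p
     + (\<chi> k. \<Sum>i\<in>UNIV. \<Sum>j\<in>UNIV. christoffel M c k i j p * X p $ i * Y p $ j)"

definition lie_bracket ::
    "('c, 'm, 'n::finite, 'z) riemannian_scheme \<Rightarrow> 'c \<Rightarrow> ('m \<Rightarrow> real ^ 'n) \<Rightarrow> ('m \<Rightarrow> real ^ 'n) \<Rightarrow> 'm \<Rightarrow> real ^ 'n" where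
  "lie_bracket M c X Y p = dird M c (X p) Y p - dird M c (Y p) X p"

definition riem_curv ::
    "('c, 'm, 'n::finite, 'z) riemannian_scheme \<Rightarrow> 'c \<Rightarrow> ('m \<Rightarrow> real ^ 'n) \<Rightarrow> ('m \<Rightarrow> real ^ 'n) \<Rightarrow> ('m \<Rightarrow> real ^ 'n) \<Rightarrow> 'm \<Rightarrow> real ^ 'n" where
  "riem_curv M c X Y Z p =
     nabla M c X (nabla M c Y Z) p - nabla M c Y (nabla M c X Z) p - nabla M c (lie_bracket M c X Y) Z p"

text \<open>\<open>Ric(Y, Z)\<close> is the trace of \<open>V \<mapsto> R(V, Y)Z\<close>; it is positive on round spheres.\<close>

definition Ric ::
    "('c, 'm, 'n::finite, 'z) riemannian_scheme \<Rightarrow> 'c \<Rightarrow> ('m \<Rightarrow> real ^ 'n) \<Rightarrow> ('m \<Rightarrow> real ^ 'n) \<Rightarrow> 'm \<Rightarrow> real" where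
  "Ric M c Y Z p = (\<Sum>k\<in>UNIV. riem_curv M c (coord_field k) Y Z p $ k)"

definition Hess ::
    "('c, 'm, 'n::finite, 'z) riemannian_scheme \<Rightarrow> ('m \<Rightarrow> real) \<Rightarrow> 'c \<Rightarrow> ('m \<Rightarrow> real ^ 'n) \<Rightarrow> ('m \<Rightarrow> real ^ 'n) \<Rightarrow> 'm \<Rightarrow> real" where
  "Hess M f c X Y p =
     dird M c (X p) (\<lambda>q. dird M c (Y q) f q) p - dird M c (nabla M c X Y p) f p"

definition Ric_f ::
    "('c, 'm, 'n::finite, 'z) riemannian_scheme \<Rightarrow> ('m \<Rightarrow> real) \<Rightarrow> 'c \<Rightarrow> ('m \<Rightarrow> real ^ 'n) \<Rightarrow> ('m \<Rightarrow> real ^ 'n) \<Rightarrow> 'm \<Rightarrow> real" where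
  "Ric_f M f c X Y p = Ric M c X Y p + Hess M f c X Y p"

text \<open>The vector that represents a covector \<open>a\<close> at \<open>p\<close> via the metric.\<close>

definition sharp ::
    "('c, 'm, 'n::finite, 'z) riemannian_scheme \<Rightarrow> 'c \<Rightarrow> 'm \<Rightarrow> real ^ 'n \<Rightarrow> real ^ 'n" where
  "sharp M c p a = matrix_inv (gram M c p) *v a"

definition grad ::
    "('c, 'm, 'n::finite, 'z) riemannian_scheme \<Rightarrow> ('m \<Rightarrow> real) \<Rightarrow> 'c \<Rightarrow> 'm \<Rightarrow> real ^ 'n" where
  "grad M f c p = sharp M c p (\<chi> k. dird M c (axis k 1) f p)"

definition Ric_f_endo ::
    "('c, 'm, 'n::finite, 'z) riemannian_scheme \<Rightarrow> ('m \<Rightarrow> real) \<Rightarrow> 'c \<Rightarrow> ('m \<Rightarrow> real ^ 'n) \<Rightarrow> 'm \<Rightarrow> real ^ 'n" where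
  "Ric_f_endo M f c X p = sharp M c p (\<chi> k. Ric_f M f c X (coord_field k) p)"


section \<open>Spin structures and spinors\<close>

text \<open>
  The spinor module is \<open>complex ^ 'k\<close> with its standard Hermitian form. A spin structure is given by
  local data: each chart domain carries an oriented orthonormal frame \<open>frm M c\<close>, and the transition
  functions between the frames, with values in the special orthogonal group, are lifted to a
  spin-group-valued cocycle \<open>lift_tr M c d\<close>. An atlas whose domains also trivialise the given
  spin structure always exists; a chart may occur repeatedly with different frames, and
  empty domains are allowed, so that the intersections of any atlas with any trivialising cover
  form such a family.
\<close>

record ('c, 'm, 'n::finite, 'k::finite) spin_manifold = "('c, 'm, 'n::finite) riemannian" +
  gam :: "'n \<Rightarrow> complex ^ 'k ^ 'k"
  frm :: "'c \<Rightarrow> 'n \<Rightarrow> 'm \<Rightarrow> real ^ 'n"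
  lift_tr :: "'c \<Rightarrow> 'c \<Rightarrow> 'm \<Rightarrow> complex ^ 'k ^ 'k"

text \<open>Dimension \<open>2 ^ \<lfloor>n/2\<rfloor>\<close> characterises the irreducible complex Clifford modules; skew-Hermitian
  generators make multiplication by vectors skew-adjoint for the Hermitian metric.\<close>

definition spin_module :: "('n::finite \<Rightarrow> complex ^ 'k ^ 'k::finite) \<Rightarrow> bool" where
  "spin_module G \<longleftrightarrow> CARD('k) = 2 ^ (CARD('n) div 2)
   \<and> (\<forall>i j. G i ** G j + G j ** G i = mat (if i = j then - 2 else 0))
   \<and> (\<forall>i a b. G i $ a $ b = - cnj (G i $ b $ a))"

definition cliff_vec :: "('n::finite \<Rightarrow> complex ^ 'k ^ 'k::finite) \<Rightarrow> real ^ 'n \<Rightarrow> complex ^ 'k ^ 'k" where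
  "cliff_vec G v = (\<Sum>i\<in>UNIV. v $ i *\<^sub>R G i)"

text \<open>The spin group (products of evenly many unit vectors in the Clifford algebra) acts faithfully on
  the spinor module and is identified with its image. Its double covering of the special orthogonal
  group maps \<open>S\<close> to the \<open>A\<close> with \<open>S v S\<^sup>-\<^sup>1 = A v\<close> for all vectors \<open>v\<close>.\<close>

inductive_set spin_group :: "('n::finite \<Rightarrow> complex ^ 'k ^ 'k::finite) \<Rightarrow> (complex ^ 'k ^ 'k) set"
  for G where
  one: "mat 1 \<in> spin_group G"
| mult: "norm v = 1 \<Longrightarrow> norm w = 1 \<Longrightarrow> S \<in> spin_group G
    \<Longrightarrow> cliff_vec G v ** cliff_vec G w ** S \<in> spin_group G"

definition frame_trans ::
    "('c, 'm, 'n::finite, 'k::finite, 'z) spin_manifold_scheme \<Rightarrow> 'c \<Rightarrow> 'c \<Rightarrow> 'm \<Rightarrow> real ^ 'n ^ 'n" where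
  "frame_trans M c d p =
     (\<chi> j i. ip M d p (dird M c (frm M c i p) (coord M d) p) (frm M d j p))"

definition oriented_frames ::
    "('c, 'm, 'n::finite, 'k::finite, 'z) spin_manifold_scheme \<Rightarrow> bool" where
  "oriented_frames M \<longleftrightarrow>
     (\<forall>c i. smooth_in M c (cdom M c) (frm M c i))
   \<and> (\<forall>c. \<forall>p\<in>cdom M c. \<forall>i j. ip M c p (frm M c i p) (frm M c j p) = (if i = j then 1 else 0))
   \<and> (\<forall>c d. \<forall>p\<in>cdom M c \<inter> cdom M d. det (frame_trans M c d p) = 1)"

definition spin_structure ::
    "('c, 'm, 'n::finite, 'k::finite, 'z) spin_manifold_scheme \<Rightarrow> bool" where
  "spin_structure M \<longleftrightarrow>
     (\<forall>c d. smooth_in M c (cdom M c \<inter> cdom M d) (lift_tr M c d))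
   \<and> (\<forall>c d. \<forall>p\<in>cdom M c \<inter> cdom M d. lift_tr M c d p \<in> spin_group (gam M)
        \<and> (\<forall>v. lift_tr M c d p ** cliff_vec (gam M) v
                = cliff_vec (gam M) (frame_trans M c d p *v v) ** lift_tr M c d p))
   \<and> (\<forall>c d e. \<forall>p\<in>cdom M c \<inter> cdom M d \<inter> cdom M e.
        lift_tr M d e p ** lift_tr M c d p = lift_tr M c e p)"

definition complete_riemannian_spin_manifold ::
    "('c, 'm::{t2_space, second_countable_topology}, 'n::finite, 'k::finite, 'z) spin_manifold_scheme \<Rightarrow> bool" where
  "complete_riemannian_spin_manifold M \<longleftrightarrow>
     smooth_atlas M \<and> riemannian_metric M \<and> riem_complete M
   \<and> spin_module (gam M) \<and> oriented_frames M \<and> spin_structure M"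

text \<open>\<open>\<psi> c\<close> is the component function of the spinor in the trivialisation over \<open>cdom M c\<close>.\<close>

definition spinor_field ::
    "('c, 'm, 'n::finite, 'k::finite, 'z) spin_manifold_scheme \<Rightarrow> ('c \<Rightarrow> 'm \<Rightarrow> complex ^ 'k) \<Rightarrow> bool" where
  "spinor_field M \<psi> \<longleftrightarrow>
     (\<forall>c. smooth_in M c (cdom M c) (\<psi> c))
   \<and> (\<forall>c d. \<forall>p\<in>cdom M c \<inter> cdom M d. \<psi> d p = lift_tr M c d p *v \<psi> c p)"

text \<open>Clifford multiplication \<open>v \<cdot> s\<close> at \<open>p\<close>; the frame vector \<open>frm M c i p\<close> acts as \<open>gam M i\<close>.\<close>

definition clmul ::
    "('c, 'm, 'n::finite, 'k::finite, 'z) spin_manifold_scheme \<Rightarrow> 'c \<Rightarrow> 'm \<Rightarrow> real ^ 'n \<Rightarrow> complex ^ 'k \<Rightarrow> complex ^ 'k" where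
  "clmul M c p v s = cliff_vec (gam M) (\<chi> i. ip M c p v (frm M c i p)) *v s"

text \<open>The spin connection, in a frame:
  \<open>\<nabla>\<^sub>X \<psi> = X(\<psi>) + 1/4 \<Sum>\<^sub>i\<^sub>j g(\<nabla>\<^sub>X e\<^sub>i, e\<^sub>j) e\<^sub>i \<cdot> e\<^sub>j \<cdot> \<psi>\<close>. The sign is the one
  for which \<open>\<nabla>\<^sub>X (Y \<cdot> \<psi>) = (\<nabla>\<^sub>X Y) \<cdot> \<psi> + Y \<cdot> \<nabla>\<^sub>X \<psi>\<close>, vectors squaring to \<open>- |v|\<^sup>2\<close>.\<close>

definition spin_nabla ::
    "('c, 'm, 'n::finite, 'k::finite, 'z) spin_manifold_scheme \<Rightarrow> 'c \<Rightarrow> ('m \<Rightarrow> real ^ 'n) \<Rightarrow> ('m \<Rightarrow> complex ^ 'k) \<Rightarrow> 'm \<Rightarrow> complex ^ 'k" where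
  "spin_nabla M c X \<psi> p = dird M c (X p) \<psi> p
     + (1 / 4) *\<^sub>R (\<Sum>i\<in>UNIV. \<Sum>j\<in>UNIV. ip M c p (nabla M c X (frm M c i) p) (frm M c j p)
         *\<^sub>R clmul M c p (frm M c i p) (clmul M c p (frm M c j p) (\<psi> p)))"

definition dirac ::
    "('c, 'm, 'n::finite, 'k::finite, 'z) spin_manifold_scheme \<Rightarrow> 'c \<Rightarrow> ('m \<Rightarrow> complex ^ 'k) \<Rightarrow> 'm \<Rightarrow> complex ^ 'k" where
  "dirac M c \<psi> p = (\<Sum>i\<in>UNIV. clmul M c p (frm M c i p) (spin_nabla M c (frm M c i) \<psi> p))"

definition dirac_f ::
    "('c, 'm, 'n::finite, 'k::finite, 'z) spin_manifold_scheme \<Rightarrow> ('m \<Rightarrow> real) \<Rightarrow> 'c \<Rightarrow> ('m \<Rightarrow> complex ^ 'k) \<Rightarrow> 'm \<Rightarrow> complex ^ 'k" where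
  "dirac_f M f c \<psi> p = dirac M c \<psi> p - (1 / 2) *\<^sub>R clmul M c p (grad M f c p) (\<psi> p)"


subsection \<open>The commutator of the weighted Dirac operator and the connection\<close>

text \<open>
  \<open>D\<^sub>f\<close> also acts on spinors with values in one-forms, through the tensor product connection
  \<open>(\<nabla>\<^sub>Y \<Psi>)(X) = \<nabla>\<^sub>Y (\<Psi>(X)) - \<Psi>(\<nabla>\<^sub>Y X)\<close>. Here \<open>\<Psi>\<close> maps vector fields to spinors.
\<close>

definition form_nabla ::
    "('c, 'm, 'n::finite, 'k::finite, 'z) spin_manifold_scheme \<Rightarrow> 'c \<Rightarrow> ('m \<Rightarrow> real ^ 'n)
      \<Rightarrow> (('m \<Rightarrow> real ^ 'n) \<Rightarrow> 'm \<Rightarrow> complex ^ 'k) \<Rightarrow> ('m \<Rightarrow> real ^ 'n) \<Rightarrow> 'm \<Rightarrow> complex ^ 'k" where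
  "form_nabla M c Y \<Psi> X p = spin_nabla M c Y (\<Psi> X) p - \<Psi> (nabla M c Y X) p"

definition form_dirac_f ::
    "('c, 'm, 'n::finite, 'k::finite, 'z) spin_manifold_scheme \<Rightarrow> ('m \<Rightarrow> real) \<Rightarrow> 'c
      \<Rightarrow> (('m \<Rightarrow> real ^ 'n) \<Rightarrow> 'm \<Rightarrow> complex ^ 'k) \<Rightarrow> ('m \<Rightarrow> real ^ 'n) \<Rightarrow> 'm \<Rightarrow> complex ^ 'k" where
  "form_dirac_f M f c \<Psi> X p =
     (\<Sum>i\<in>UNIV. clmul M c p (frm M c i p) (form_nabla M c (frm M c i) \<Psi> X p))
     - (1 / 2) *\<^sub>R clmul M c p (grad M f c p) (\<Psi> X p)"

text \<open>
  If \<open>[D\<^sub>f, \<nabla>\<^sub>X]\<close> is the commutator of two operators on spinors, the extra term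
  \<open>\<Sum>\<^sub>i e\<^sub>i \<cdot> \<nabla>\<^bsub>\<nabla>\<^bsub>e_i\<^esub> X\<^esub> \<psi>\<close> appears, which depends on the derivative of \<open>X\<close>
  and vanishes where \<open>\<nabla>X = 0\<close>. The tensorial commutator, with \<open>D\<^sub>f \<nabla>\<^sub>X \<psi> = (D\<^sub>f (\<nabla>\<psi>))(X)\<close>,
  does not have it; the two agree at the points where \<open>\<nabla>X = 0\<close>.
\<close>

definition op_commutator ::
    "('c, 'm, 'n::finite, 'k::finite, 'z) spin_manifold_scheme \<Rightarrow> ('m \<Rightarrow> real) \<Rightarrow> 'c
      \<Rightarrow> ('m \<Rightarrow> real ^ 'n) \<Rightarrow> ('m \<Rightarrow> complex ^ 'k) \<Rightarrow> 'm \<Rightarrow> complex ^ 'k" where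
  "op_commutator M f c X \<psi> p =
     dirac_f M f c (spin_nabla M c X \<psi>) p - spin_nabla M c X (dirac_f M f c \<psi>) p"

definition tensor_commutator ::
    "('c, 'm, 'n::finite, 'k::finite, 'z) spin_manifold_scheme \<Rightarrow> ('m \<Rightarrow> real) \<Rightarrow> 'c
      \<Rightarrow> ('m \<Rightarrow> real ^ 'n) \<Rightarrow> ('m \<Rightarrow> complex ^ 'k) \<Rightarrow> 'm \<Rightarrow> complex ^ 'k" where
  "tensor_commutator M f c X \<psi> p =
     form_dirac_f M f c (\<lambda>Y. spin_nabla M c Y \<psi>) X p - spin_nabla M c X (dirac_f M f c \<psi>) p"

end

theory Submission
  imports Defs
begin

text \<open>
  In the trivialisation over one chart, \<open>\<nabla>\<^sub>X\<close> on spinors is the directional derivative plus the image of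
  the connection form of the frame under the spin representation. Hence the curvature of the spinor
  bundle is the image of the Riemannian curvature form. By the Leibniz rule for Clifford
  multiplication the tensorial commutator is
  \<open>\<Sum>\<^sub>i e\<^sub>i \<cdot> R(e\<^sub>i, X) \<psi> + 1/2 (\<nabla>\<^sub>X grad f) \<cdot> \<psi>\<close>, because the two terms that contain
  \<open>\<nabla>\<^sub>X e\<^sub>i\<close> cancel. The curvature symmetries contract the cubic Clifford expression in the first
  term to \<open>1/2 Ric(X) \<cdot> \<psi>\<close>, and the second term is the Hessian.
\<close>

section \<open>Symmetry of second derivatives\<close>

text \<open>The orthonormal frame belongs to the trivialisation of the spinors over the chart, so it
  cannot be exchanged for one that is parallel at the point considered. The connection terms are
  carried along and removed by skewness of the connection form. For this reason covariant
  derivatives are taken in the direction of a single tangent vector (\<open>cov\<close>,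
  \<open>scov\<close>) and are linear in it, and curvature is the pointwise expression
  \<open>Rm\<close>. The cubic contraction needs a cyclic identity with \<open>X\<close> fixed in
  the second slot of the curvature. That is the Bianchi identity only after pair symmetry, which in
  turn needs skewness in the last two slots for arbitrary vectors. The factor 1/2 has two origins.
  For Ricci it is (1/4)(-2)(-1): the normalisation of the spin representation, the constant of the
  cubic contraction, and a sign from skewness. For the Hessian it is the -1/2 of the weighted Dirac
  operator with its sign reversed, since \<open>grad f\<close> is differentiated only in the
  subtracted term.\<close>

lemma mixed_difference_mean_value:
  fixes F :: "'a::real_normed_vector \<Rightarrow> real"
  assumes h: "h > 0"
    and S: "\<And>s t. 0 \<le> s \<Longrightarrow> s \<le> h \<Longrightarrow> 0 \<le> t \<Longrightarrow> t \<le> h \<Longrightarrow> x + s *\<^sub>R v + t *\<^sub>R w \<in> S"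
    and F': "\<And>y. y \<in> S \<Longrightarrow> (F has_derivative F' y) (at y)"
    and F'': "\<And>y. y \<in> S \<Longrightarrow> ((\<lambda>z. F' z v) has_derivative F'' y) (at y)"
  obtains s t where "0 < s" "s < h" "0 < t" "t < h"
    "F (x + h *\<^sub>R v + h *\<^sub>R w) - F (x + h *\<^sub>R v) - F (x + h *\<^sub>R w) + F x
      = h * h * F'' (x + s *\<^sub>R v + t *\<^sub>R w) w"
proof -
  \<comment> \<open>The increment of \<open>F\<close> along \<open>h w\<close>, as a function of the
    position along \<open>v\<close>. One mean value theorem in \<open>s\<close> and a second one in
    \<open>t\<close> for its derivative produce the mixed second derivative.\<close>
  define \<phi> where "\<phi> s = F (x + s *\<^sub>R v + h *\<^sub>R w) - F (x + s *\<^sub>R v)" for s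
  have line: "((\<lambda>r. G (a + r *\<^sub>R u)) has_real_derivative G' u) (at r)"
    if "(G has_derivative G') (at (a + r *\<^sub>R u))" for G :: "'a \<Rightarrow> real" and G' a u r
  proof -
    have "((\<lambda>r. a + r *\<^sub>R u) has_derivative (\<lambda>k. k *\<^sub>R u)) (at r)"
      by (auto intro!: derivative_eq_intros)
    from has_derivative_compose[OF this that]
    have "((\<lambda>r. G (a + r *\<^sub>R u)) has_derivative (\<lambda>k. G' (k *\<^sub>R u))) (at r)" .
    moreover have "(\<lambda>k. G' (k *\<^sub>R u)) = (*) (G' u)"
      using linear_scale[OF has_derivative_linear[OF that]] by auto
    ultimately show ?thesis by (simp add: has_field_derivative_def)
  qed
  have d\<phi>: "(\<phi> has_real_derivative F' (x + s *\<^sub>R v + h *\<^sub>R w) v - F' (x + s *\<^sub>R v) v) (at s)"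
    if "0 \<le> s" "s \<le> h" for s
  proof -
    have 1: "x + s *\<^sub>R v + h *\<^sub>R w \<in> S" "x + s *\<^sub>R v \<in> S"
      using S[of s h] S[of s 0] that h by auto
    have "((\<lambda>r. F ((x + h *\<^sub>R w) + r *\<^sub>R v)) has_real_derivative F' (x + s *\<^sub>R v + h *\<^sub>R w) v) (at s)"
      by (rule line) (use F'[OF 1(1)] in \<open>simp add: algebra_simps\<close>)
    moreover have "((\<lambda>r. F (x + r *\<^sub>R v)) has_real_derivative F' (x + s *\<^sub>R v) v) (at s)"
      by (rule line) (use F'[OF 1(2)] in simp)
    ultimately show ?thesis unfolding \<phi>_def
      by (auto intro!: derivative_eq_intros simp: algebra_simps)
  qed
  obtain s where s: "0 < s" "s < h"
    "\<phi> h - \<phi> 0 = (h - 0) * (F' (x + s *\<^sub>R v + h *\<^sub>R w) v - F' (x + s *\<^sub>R v) v)"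
    using MVT2[OF h d\<phi>] by auto
  have "((\<lambda>r. F' ((x + s *\<^sub>R v) + r *\<^sub>R w) v) has_real_derivative F'' (x + s *\<^sub>R v + t *\<^sub>R w) w) (at t)"
    if "0 \<le> t" "t \<le> h" for t
    by (rule line) (use F'' S that s in auto)
  from MVT2[OF h this] obtain t where t: "0 < t" "t < h"
    "F' (x + s *\<^sub>R v + h *\<^sub>R w) v - F' (x + s *\<^sub>R v) v = (h - 0) * F'' (x + s *\<^sub>R v + t *\<^sub>R w) w"
    by auto
  show ?thesis
    by (rule that[OF s(1,2) t(1,2)]) (use s(3) t(3) in \<open>simp add: \<phi>_def\<close>)
qed

text \<open>The second difference of \<open>F\<close> over a parallelogram is symmetric in
  \<open>v\<close> and \<open>w\<close>, so it equals \<open>h * h\<close> times either mixed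
  derivative at some nearby point. Continuity carries the equality to \<open>x\<close>.\<close>

lemma mixed_derivatives_commute_real:
  fixes F :: "'a::real_normed_vector \<Rightarrow> real"
  assumes S: "open S" "x \<in> S"
    and F': "\<And>y. y \<in> S \<Longrightarrow> (F has_derivative F' y) (at y)"
    and V: "\<And>y. y \<in> S \<Longrightarrow> ((\<lambda>z. F' z v) has_derivative V y) (at y)"
    and W: "\<And>y. y \<in> S \<Longrightarrow> ((\<lambda>z. F' z w) has_derivative W y) (at y)"
    and cont: "continuous_on S (\<lambda>y. V y w)" "continuous_on S (\<lambda>y. W y v)"
  shows "V x w = W x v"
proof (rule ccontr)
  assume ne: "V x w \<noteq> W x v"
  \<comment> \<open>Half the gap: a common value within \<open>e\<close> of both sides contradicts
    their distance being \<open>2 * e\<close>.\<close>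
  define e where "e = dist (V x w) (W x v) / 2"
  have e: "e > 0" using ne by (simp add: e_def)
  have lim: "((\<lambda>y. V y w) \<longlongrightarrow> V x w) (nhds x)" "((\<lambda>y. W y v) \<longlongrightarrow> W x v) (nhds x)"
    using cont S by (simp_all add: continuous_on_eq_continuous_at isCont_def
      tendsto_at_iff_tendsto_nhds[of "\<lambda>y. V y w"] tendsto_at_iff_tendsto_nhds[of "\<lambda>y. W y v"])
  have "\<forall>\<^sub>F y in nhds x. y \<in> S \<and> dist (V y w) (V x w) < e \<and> dist (W y v) (W x v) < e"
    using S lim e
    by (intro eventually_conj eventually_nhds_in_open tendstoD) auto
  then obtain d where d: "d > 0"
    "\<And>y. dist y x < d \<Longrightarrow> y \<in> S \<and> dist (V y w) (V x w) < e \<and> dist (W y v) (W x v) < e"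
    unfolding eventually_nhds_metric by blast
  \<comment> \<open>With \<open>h * N = d / 2\<close> the whole parallelogram stays in the ball of
    radius \<open>d\<close>; the summand 1 keeps \<open>N\<close> positive when \<open>v\<close> and
    \<open>w\<close> vanish.\<close>
  define N where "N = norm v + norm w + 1"
  define h where "h = d / (2 * (N))"
  have pos: "N > 0" by (simp add: N_def add_nonneg_pos)
  have h: "h > 0" using d(1) pos by (simp add: h_def)
  have near: "dist (x + s *\<^sub>R v + t *\<^sub>R w) x < d"
    if "0 \<le> s" "s \<le> h" "0 \<le> t" "t \<le> h" for s t
  proof -
    have "dist (x + s *\<^sub>R v + t *\<^sub>R w) x = norm (s *\<^sub>R v + t *\<^sub>R w)"
      by (simp add: dist_norm add.assoc)
    also have "\<dots> \<le> s * norm v + t * norm w"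
      using norm_triangle_ineq[of "s *\<^sub>R v" "t *\<^sub>R w"] that by simp
    also have "\<dots> \<le> h * norm v + h * norm w"
      using that by (intro add_mono mult_right_mono) auto
    also have "\<dots> \<le> h * (N)"
      using h by (simp add: N_def algebra_simps)
    also have "\<dots> = d / 2" using pos by (simp add: h_def)
    finally show ?thesis using d(1) by simp
  qed
  obtain s t where st: "0 < s" "s < h" "0 < t" "t < h"
    "F (x + h *\<^sub>R v + h *\<^sub>R w) - F (x + h *\<^sub>R v) - F (x + h *\<^sub>R w) + F x
      = h * h * V (x + s *\<^sub>R v + t *\<^sub>R w) w"
    by (rule mixed_difference_mean_value[OF h, where S=S and F'=F' and F''=V and v=v and w=w and x=x])
       (use near d F' V in auto)
  obtain s' t' where st': "0 < s'" "s' < h" "0 < t'" "t' < h"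
    "F (x + h *\<^sub>R w + h *\<^sub>R v) - F (x + h *\<^sub>R w) - F (x + h *\<^sub>R v) + F x
      = h * h * W (x + s' *\<^sub>R w + t' *\<^sub>R v) v"
    by (rule mixed_difference_mean_value[OF h, where S=S and F'=F' and F''=W and v=w and w=v and x=x])
       (use near d F' W in \<open>auto simp: add.assoc add.commute[of "_ *\<^sub>R w"]\<close>)
  have "x + h *\<^sub>R w + h *\<^sub>R v = x + h *\<^sub>R v + h *\<^sub>R w" by simp
  then have "V (x + s *\<^sub>R v + t *\<^sub>R w) w = W (x + t' *\<^sub>R v + s' *\<^sub>R w) v"
    using st(5) st'(5) h by (simp add: algebra_simps)
  moreover have "dist (V (x + s *\<^sub>R v + t *\<^sub>R w) w) (V x w) < e"
    using d(2)[OF near[of s t]] st by auto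
  moreover have "dist (W (x + t' *\<^sub>R v + s' *\<^sub>R w) v) (W x v) < e"
    using d(2)[OF near[of t' s']] st' by auto
  ultimately have "dist (V x w) (W x v) < 2 * e"
    by (simp add: dist_real_def)
  then show False by (simp add: e_def)
qed

text \<open>The mean value theorem yields an equality only for real values, so the argument runs
  through the components along a basis of the target.\<close>

lemma Ck_on_2_derivatives_commute:
  fixes F :: "'a::real_normed_vector \<Rightarrow> 'b::euclidean_space"
  assumes S: "open S" "x \<in> S" and F: "Ck_on 2 S F"
  shows "frechet_derivative (\<lambda>y. frechet_derivative F (at y) v) (at x) w
       = frechet_derivative (\<lambda>y. frechet_derivative F (at y) w) (at x) v"
proof (rule euclidean_eqI)
  fix b :: 'b assume "b \<in> Basis"
  let ?D = "\<lambda>v y. frechet_derivative F (at y) v"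
  have F1: "F differentiable at y" if "y \<in> S" for y
    using F that by (auto simp: numeral_2_eq_2)
  have F2: "?D v differentiable at y" if "y \<in> S" for v y
    using F that by (auto simp: numeral_2_eq_2)
  have F3: "continuous_on S (\<lambda>y. frechet_derivative (?D v) (at y) w)" for v w
    using F by (auto simp: numeral_2_eq_2)
  show "frechet_derivative (?D v) (at x) w \<bullet> b = frechet_derivative (?D w) (at x) v \<bullet> b"
  proof (rule mixed_derivatives_commute_real[OF S,
      where F="\<lambda>y. F y \<bullet> b" and F'="\<lambda>y v. ?D v y \<bullet> b" and v=v and w=w])
    show "((\<lambda>y. F y \<bullet> b) has_derivative (\<lambda>v. ?D v y \<bullet> b)) (at y)" if "y \<in> S" for y
      using F1[OF that] by (auto intro!: derivative_eq_intros simp: frechet_derivative_works)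
    show "((\<lambda>y. ?D v y \<bullet> b) has_derivative (\<lambda>w. frechet_derivative (?D v) (at y) w \<bullet> b)) (at y)"
      if "y \<in> S" for y
      using F2[OF that] by (auto intro!: derivative_eq_intros simp: frechet_derivative_works)
    show "((\<lambda>y. ?D w y \<bullet> b) has_derivative (\<lambda>v. frechet_derivative (?D w) (at y) v \<bullet> b)) (at y)"
      if "y \<in> S" for y
      using F2[OF that] by (auto intro!: derivative_eq_intros simp: frechet_derivative_works)
  qed (intro continuous_intros F3)+
qed

section \<open>Directional derivatives in a chart\<close>

locale chart =
  fixes M :: "('c, 'm::{t2_space, second_countable_topology}, 'n::finite, 'z) riemannian_scheme"
    and c :: 'c
  assumes atlas: "smooth_atlas M"
begin

definition dif :: "('m \<Rightarrow> 'b::real_normed_vector) \<Rightarrow> bool" where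
  "dif F \<longleftrightarrow> (\<forall>p\<in>cdom M c. in_chart M c F differentiable at (coord M c p))"

definition C2 :: "('m \<Rightarrow> 'b::real_normed_vector) \<Rightarrow> bool" where
  "C2 F \<longleftrightarrow> Ck_on 2 (coord M c ` cdom M c) (in_chart M c F)"

lemma open_image: "open (coord M c ` cdom M c)"
  using atlas by (simp add: smooth_atlas_def)

lemma inv_coord [simp]: "p \<in> cdom M c \<Longrightarrow> inv_into (cdom M c) (coord M c) (coord M c p) = p"
proof -
  have "homeomorphism (cdom M c) (coord M c ` cdom M c) (coord M c) (inv_into (cdom M c) (coord M c))"
    using atlas by (simp add: smooth_atlas_def)
  then show "p \<in> cdom M c \<Longrightarrow> inv_into (cdom M c) (coord M c) (coord M c p) = p"
    by (rule homeomorphism_apply1)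
qed

lemma in_chart_coord [simp]: "p \<in> cdom M c \<Longrightarrow> in_chart M c F (coord M c p) = F p"
  by (simp add: in_chart_def)

lemma has_derivative_dird:
  "dif F \<Longrightarrow> p \<in> cdom M c \<Longrightarrow>
    (in_chart M c F has_derivative (\<lambda>v. dird M c v F p)) (at (coord M c p))"
  by (simp add: dif_def dird_def frechet_derivative_works)

lemma dird_eq:
  "(in_chart M c F has_derivative F') (at (coord M c p)) \<Longrightarrow> dird M c v F p = F' v"
  by (simp add: dird_def frechet_derivative_at[symmetric])

text \<open>A derivative sees only a neighbourhood and the coordinate image is open. Hence pointwise
  formulas valid only on \<open>cdom M c\<close> may be substituted under derivatives
  throughout.\<close>

lemma has_derivative_cong_image:
  assumes "\<And>x. x \<in> coord M c ` cdom M c \<Longrightarrow> G x = H x" and "x \<in> coord M c ` cdom M c"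
  shows "(G has_derivative G') (at x) \<longleftrightarrow> (H has_derivative G') (at x)"
proof
  show "(G has_derivative G') (at x) \<Longrightarrow> (H has_derivative G') (at x)"
    by (erule has_derivative_transform_within_open[OF _ open_image assms(2)]) (rule assms(1))
  show "(H has_derivative G') (at x) \<Longrightarrow> (G has_derivative G') (at x)"
    by (erule has_derivative_transform_within_open[OF _ open_image assms(2)]) (rule assms(1)[symmetric])
qed

lemma has_derivative_in_chart_cong:
  assumes "\<And>q. q \<in> cdom M c \<Longrightarrow> F q = G q" and p: "p \<in> cdom M c"
  shows "(in_chart M c F has_derivative F') (at (coord M c p))
    \<longleftrightarrow> (in_chart M c G has_derivative F') (at (coord M c p))"
  by (rule has_derivative_cong_image) (use assms in auto)

lemma dif_cong: "(\<And>q. q \<in> cdom M c \<Longrightarrow> F q = G q) \<Longrightarrow> dif F = dif G"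
  unfolding dif_def differentiable_def using has_derivative_in_chart_cong[of F G] by blast

lemma dird_cong:
  assumes "\<And>q. q \<in> cdom M c \<Longrightarrow> F q = G q" and "p \<in> cdom M c"
  shows "dird M c v F p = dird M c v G p"
proof -
  \<comment> \<open>\<open>frechet_derivative\<close> is a choice among the derivatives, so equality
    of the predicates gives equal values even where no derivative exists.\<close>
  have "(\<lambda>F'. (in_chart M c F has_derivative F') (at (coord M c p)))
      = (\<lambda>F'. (in_chart M c G has_derivative F') (at (coord M c p)))"
    by (intro ext has_derivative_in_chart_cong assms)
  then show ?thesis by (simp add: dird_def frechet_derivative_def)
qed

lemma linear_dird: "dif F \<Longrightarrow> p \<in> cdom M c \<Longrightarrow> linear (\<lambda>v. dird M c v F p)"
  by (rule has_derivative_linear[OF has_derivative_dird])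

lemma dird_expand:
  assumes "dif F" "p \<in> cdom M c"
  shows "dird M c v F p = (\<Sum>i\<in>UNIV. v $ i *\<^sub>R dird M c (axis i 1) F p)"
proof -
  interpret linear "\<lambda>v. dird M c v F p" by (rule linear_dird[OF assms])
  have "dird M c (\<Sum>i\<in>UNIV. v $ i *\<^sub>R axis i 1) F p = (\<Sum>i\<in>UNIV. v $ i *\<^sub>R dird M c (axis i 1) F p)"
    by (simp add: sum scale)
  then show ?thesis using basis_expansion[of v] by (simp add: scalar_mult_eq_scaleR)
qed

lemma in_chart_lift: "in_chart M c (\<lambda>q. h (F q)) = (\<lambda>x. h (in_chart M c F x))"
  "in_chart M c (\<lambda>q. k (F q) (G q)) = (\<lambda>x. k (in_chart M c F x) (in_chart M c G x))"
  by (simp_all add: in_chart_def o_def)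

lemma dif_const [intro, simp]: "dif (\<lambda>q. a)"
  by (simp add: dif_def in_chart_def o_def)

lemma dird_const [simp]: "dird M c v (\<lambda>q. a) p = 0"
  by (simp add: dird_def in_chart_def o_def)

lemma dif_bounded_linear:
  assumes "bounded_linear h" "dif F"
  shows "dif (\<lambda>q. h (F q))"
    and "p \<in> cdom M c \<Longrightarrow> dird M c v (\<lambda>q. h (F q)) p = h (dird M c v F p)"
proof -
  have *: "(in_chart M c (\<lambda>q. h (F q)) has_derivative (\<lambda>v. h (dird M c v F p))) (at (coord M c p))"
    if "p \<in> cdom M c" for p
    unfolding in_chart_lift(1)[of h F] using bounded_linear.has_derivative[OF assms(1) has_derivative_dird[OF assms(2) that]] .
  show "dif (\<lambda>q. h (F q))" using * by (auto simp: dif_def differentiable_def)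
  show "p \<in> cdom M c \<Longrightarrow> dird M c v (\<lambda>q. h (F q)) p = h (dird M c v F p)"
    using dird_eq[OF *] by simp
qed

lemma dif_bounded_bilinear:
  assumes "bounded_bilinear k" "dif F" "dif G"
  shows "dif (\<lambda>q. k (F q) (G q))"
    and "p \<in> cdom M c \<Longrightarrow>
      dird M c v (\<lambda>q. k (F q) (G q)) p = k (F p) (dird M c v G p) + k (dird M c v F p) (G p)"
proof -
  have *: "(in_chart M c (\<lambda>q. k (F q) (G q)) has_derivative
      (\<lambda>v. k (F p) (dird M c v G p) + k (dird M c v F p) (G p))) (at (coord M c p))"
    if "p \<in> cdom M c" for p
    unfolding in_chart_lift(2)[of k F G] using bounded_bilinear.FDERIV[OF assms(1) has_derivative_dird[OF assms(2) that]
      has_derivative_dird[OF assms(3) that]] that by simp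
  show "dif (\<lambda>q. k (F q) (G q))" using * by (auto simp: dif_def differentiable_def)
  show "p \<in> cdom M c \<Longrightarrow>
      dird M c v (\<lambda>q. k (F q) (G q)) p = k (F p) (dird M c v G p) + k (dird M c v F p) (G p)"
    using dird_eq[OF *] by simp
qed

lemma dif_add:
  assumes "dif F" "dif G"
  shows "dif (\<lambda>q. F q + G q)"
    and "p \<in> cdom M c \<Longrightarrow> dird M c v (\<lambda>q. F q + G q) p = dird M c v F p + dird M c v G p"
proof -
  have *: "(in_chart M c (\<lambda>q. F q + G q) has_derivative
      (\<lambda>v. dird M c v F p + dird M c v G p)) (at (coord M c p))"
    if "p \<in> cdom M c" for p
    unfolding in_chart_lift(2)[of "(+)" F G]
    by (intro has_derivative_add has_derivative_dird assms that)
  show "dif (\<lambda>q. F q + G q)" using * by (auto simp: dif_def differentiable_def)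
  show "p \<in> cdom M c \<Longrightarrow> dird M c v (\<lambda>q. F q + G q) p = dird M c v F p + dird M c v G p"
    using dird_eq[OF *] by simp
qed

lemmas dif_scaleR = dif_bounded_bilinear[OF bounded_bilinear_scaleR]
lemmas dif_mult = dif_bounded_bilinear[OF bounded_bilinear_mult]
lemmas dif_scaleR_const = dif_bounded_linear[OF bounded_linear_scaleR_right]
lemmas dif_nth = dif_bounded_linear[OF bounded_linear_vec_nth]
lemmas dif_minus = dif_bounded_linear[OF bounded_linear_minus[OF bounded_linear_ident]]

lemma dif_diff:
  assumes "dif F" "dif G"
  shows "dif (\<lambda>q. F q - G q)"
    and "p \<in> cdom M c \<Longrightarrow> dird M c v (\<lambda>q. F q - G q) p = dird M c v F p - dird M c v G p"
  using dif_add[OF assms(1) dif_minus(1)[OF assms(2)]] dif_minus(2)[OF assms(2)] by simp_all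

lemma dif_sum:
  assumes "finite I" "\<And>i. i \<in> I \<Longrightarrow> dif (F i)"
  shows "dif (\<lambda>q. \<Sum>i\<in>I. F i q)"
    and "p \<in> cdom M c \<Longrightarrow> dird M c v (\<lambda>q. \<Sum>i\<in>I. F i q) p = (\<Sum>i\<in>I. dird M c v (F i) p)"
proof -
  have "dif (\<lambda>q. \<Sum>i\<in>I. F i q) \<and>
      (p \<in> cdom M c \<longrightarrow> dird M c v (\<lambda>q. \<Sum>i\<in>I. F i q) p = (\<Sum>i\<in>I. dird M c v (F i) p))"
    using assms by (induction) (simp_all add: dif_add)
  then show "dif (\<lambda>q. \<Sum>i\<in>I. F i q)"
    and "p \<in> cdom M c \<Longrightarrow> dird M c v (\<lambda>q. \<Sum>i\<in>I. F i q) p = (\<Sum>i\<in>I. dird M c v (F i) p)"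
    by auto
qed

lemma dif_vec:
  fixes F :: "'i::finite \<Rightarrow> 'm \<Rightarrow> 'b::euclidean_space"
  assumes "\<And>i. dif (F i)"
  shows "dif (\<lambda>q. \<chi> i. F i q)"
    and "p \<in> cdom M c \<Longrightarrow> dird M c v (\<lambda>q. \<chi> i. F i q) p = (\<chi> i. dird M c v (F i) p)"
proof -
  \<comment> \<open>A vector-valued map is a finite sum of its components embedded by the bounded
    linear maps \<open>axis i\<close>, which reduces the claim to sums.\<close>
  have eq: "(\<lambda>q. \<chi> i. F i q) = (\<lambda>q. \<Sum>i\<in>UNIV. axis i (F i q))"
    by (auto simp: fun_eq_iff vec_eq_iff axis_def if_distrib[of "\<lambda>x. x $ _"] sum.delta)
  have lin: "bounded_linear (axis i :: 'b \<Rightarrow> 'b ^ 'i)" for i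
    by (rule linear_conv_bounded_linear[THEN iffD1], rule linearI)
       (auto simp: vec_eq_iff axis_def)
  show "dif (\<lambda>q. \<chi> i. F i q)" unfolding eq
    by (intro dif_sum dif_bounded_linear[OF lin] assms finite)
  show "p \<in> cdom M c \<Longrightarrow> dird M c v (\<lambda>q. \<chi> i. F i q) p = (\<chi> i. dird M c v (F i) p)"
    unfolding eq
    by (subst dif_sum(2)[OF finite dif_bounded_linear(1)[OF lin assms]], assumption)
       (simp only: dif_bounded_linear(2)[OF lin assms], simp add: vec_eq_iff axis_def
          if_distrib[of "\<lambda>x. x $ _"] sum.delta)
qed

section \<open>Second directional derivatives and the Lie bracket\<close>

lemma C2_const [intro, simp]: "C2 (\<lambda>q. a)"
  by (simp add: C2_def in_chart_def o_def numeral_2_eq_2)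

lemma C2_if_smooth: "smooth_in M c (cdom M c) F \<Longrightarrow> C2 F"
  by (simp add: C2_def smooth_in_def smooth_on_def)

lemma C2_dif: "C2 F \<Longrightarrow> dif F"
  by (simp add: C2_def dif_def numeral_2_eq_2)

lemma in_chart_dird:
  "x \<in> coord M c ` cdom M c \<Longrightarrow>
    in_chart M c (dird M c v F) x = frechet_derivative (in_chart M c F) (at x) v"
  by (auto simp: dird_def)

lemma has_derivative_in_chart_dird:
  assumes "p \<in> cdom M c"
  shows "(in_chart M c (dird M c v F) has_derivative G) (at (coord M c p)) \<longleftrightarrow>
    ((\<lambda>x. frechet_derivative (in_chart M c F) (at x) v) has_derivative G) (at (coord M c p))"
  by (rule has_derivative_cong_image[OF in_chart_dird imageI[OF assms]])

lemma dif_dird: "C2 F \<Longrightarrow> dif (dird M c v F)"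
  by (simp add: C2_def numeral_2_eq_2 dif_def differentiable_def has_derivative_in_chart_dird)

lemma dird_commute:
  fixes F :: "'m \<Rightarrow> 'b::euclidean_space"
  assumes F: "C2 F" and p: "p \<in> cdom M c"
  shows "dird M c v (dird M c w F) p = dird M c w (dird M c v F) p"
proof -
  have "dird M c v (dird M c w F) p
      = frechet_derivative (\<lambda>x. frechet_derivative (in_chart M c F) (at x) w) (at (coord M c p)) v" for v w
    by (simp add: dird_def[of M c v] frechet_derivative_def[of _ "at (coord M c p)"]
        has_derivative_in_chart_dird[OF p])
  then show ?thesis
    using Ck_on_2_derivatives_commute[OF open_image imageI[OF p], of "in_chart M c F" v w] F
    by (simp add: C2_def)
qed

text \<open>The direction varies with the point. Expanding it in the coordinate directions turns the
  claim into a product rule: one term differentiates the components of \<open>X\<close>, the other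
  keeps the direction frozen at \<open>p\<close>.\<close>

lemma dif_dird_field:
  assumes F: "C2 F" and X: "dif X"
  shows "dif (\<lambda>q. dird M c (X q) F q)"
    and "p \<in> cdom M c \<Longrightarrow> dird M c v (\<lambda>q. dird M c (X q) F q) p
      = dird M c (dird M c v X p) F p + dird M c v (dird M c (X p) F) p"
proof -
  note expand = dird_expand[OF C2_dif[OF F]]
  have "dif (\<lambda>q. \<Sum>i\<in>UNIV. X q $ i *\<^sub>R dird M c (axis i 1) F q)"
    by (intro dif_sum finite dif_scaleR dif_nth X dif_dird F)
  then show "dif (\<lambda>q. dird M c (X q) F q)"
    by (subst dif_cong[where G="\<lambda>q. \<Sum>i\<in>UNIV. X q $ i *\<^sub>R dird M c (axis i 1) F q", OF expand])
  assume p: "p \<in> cdom M c"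
  have "dird M c v (dird M c (X p) F) p
      = dird M c v (\<lambda>q. \<Sum>i\<in>UNIV. X p $ i *\<^sub>R dird M c (axis i 1) F q) p"
    by (rule dird_cong[OF _ p]) (rule expand)
  moreover have "dird M c v (\<lambda>q. dird M c (X q) F q) p
      = dird M c v (\<lambda>q. \<Sum>i\<in>UNIV. X q $ i *\<^sub>R dird M c (axis i 1) F q) p"
    by (rule dird_cong[OF _ p]) (rule expand)
  ultimately show "dird M c v (\<lambda>q. dird M c (X q) F q) p
      = dird M c (dird M c v X p) F p + dird M c v (dird M c (X p) F) p"
    using p expand[OF p, of "dird M c v X p"]
    by (simp add: dif_sum dif_scaleR dif_nth X dif_dird F dif_scaleR_const sum.distrib add.commute)
qed

text \<open>The terms with both directions frozen cancel by symmetry of second derivatives; only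
  derivatives of the components of \<open>X\<close> and \<open>Y\<close> survive, and they form the
  bracket.\<close>

lemma dird_lie_bracket:
  fixes F :: "'m \<Rightarrow> 'b::euclidean_space"
  assumes F: "C2 F" and X: "dif X" and Y: "dif Y" and p: "p \<in> cdom M c"
  shows "dird M c (X p) (\<lambda>q. dird M c (Y q) F q) p - dird M c (Y p) (\<lambda>q. dird M c (X q) F q) p
    = dird M c (lie_bracket M c X Y p) F p"
  using dird_commute[OF F p, of "X p" "Y p"] linear_diff[OF linear_dird[OF C2_dif[OF F] p]]
  by (simp add: dif_dird_field(2)[OF F X p] dif_dird_field(2)[OF F Y p] lie_bracket_def)

end

section \<open>Clifford modules and the spin representation\<close>

lemma sum_rotate3:
  "(\<Sum>k\<in>A. \<Sum>i\<in>B. \<Sum>j\<in>C. f k i j) = (\<Sum>i\<in>B. \<Sum>j\<in>C. \<Sum>k\<in>A. f k i j)"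
  by (subst sum.swap) (intro sum.cong refl sum.swap)

text \<open>The scalars are real because the components of vectors and connection forms are real;
  the identities below follow from anticommutation alone.\<close>

locale clifford_module =
  fixes \<gamma> :: "'n::finite \<Rightarrow> 's::real_vector \<Rightarrow> 's"
  assumes linear_\<gamma>: "linear (\<gamma> i)"
    and anticommute: "\<gamma> i (\<gamma> j s) + \<gamma> j (\<gamma> i s) = (if i = j then - 2 else 0) *\<^sub>R s"
begin

text \<open>For skew \<open>a\<close> this is the differential of the spin representation, that is,
  of the inverse of the double covering on Lie algebras. The factor 1/4 makes the coefficient in
  \<open>spin_rep_\<gamma>\<close> equal to 1.\<close>

definition spin_rep :: "('n \<Rightarrow> 'n \<Rightarrow> real) \<Rightarrow> 's \<Rightarrow> 's" where
  "spin_rep a s = (1 / 4) *\<^sub>R (\<Sum>i\<in>UNIV. \<Sum>j\<in>UNIV. a i j *\<^sub>R \<gamma> i (\<gamma> j s))"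

lemmas \<gamma>_simps = linear_add[OF linear_\<gamma>] linear_diff[OF linear_\<gamma>] linear_scale[OF linear_\<gamma>]
  linear_sum[OF linear_\<gamma>] linear_0[OF linear_\<gamma>] linear_neg[OF linear_\<gamma>]

lemma linear_spin_rep: "linear (spin_rep a)"
  unfolding spin_rep_def
  by (rule linearI) (simp_all add: \<gamma>_simps scaleR_add_right sum.distrib scaleR_sum_right ac_simps)

lemma spin_rep_add: "spin_rep (\<lambda>i j. a i j + b i j) s = spin_rep a s + spin_rep b s"
  by (simp add: spin_rep_def scaleR_add_left sum.distrib scaleR_add_right)

lemma spin_rep_diff: "spin_rep (\<lambda>i j. a i j - b i j) s = spin_rep a s - spin_rep b s"
  by (simp add: spin_rep_def scaleR_diff_left sum_subtractf scaleR_diff_right)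

text \<open>Two anticommutations bring \<open>\<gamma> k\<close> to the front. Their signs cancel
  and each leaves one contraction.\<close>

lemma \<gamma>_cycle:
  "\<gamma> i (\<gamma> j (\<gamma> k s)) = \<gamma> k (\<gamma> i (\<gamma> j s))
     + (if i = k then 2 else 0) *\<^sub>R \<gamma> j s - (if j = k then 2 else 0) *\<^sub>R \<gamma> i s"
proof -
  have swap: "\<gamma> i (\<gamma> j s) = (if i = j then - 2 else 0) *\<^sub>R s - \<gamma> j (\<gamma> i s)" for i j s
    by (simp only: eq_diff_eq anticommute)
  have "\<gamma> i (\<gamma> j (\<gamma> k s)) = (if j = k then - 2 else 0) *\<^sub>R \<gamma> i s - \<gamma> i (\<gamma> k (\<gamma> j s))"
    by (subst swap[of j k]) (simp only: \<gamma>_simps)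
  then show ?thesis
    by (simp add: swap[of i k "\<gamma> j s"])
qed

lemma sum_if_first:
  "(\<Sum>i\<in>UNIV. \<Sum>j\<in>UNIV. a i j *\<^sub>R (if i = k then 2 else 0) *\<^sub>R (f j :: 's))
    = 2 *\<^sub>R (\<Sum>j\<in>UNIV. a (k::'n) (j::'n) *\<^sub>R f j)"
proof -
  have "(\<Sum>i\<in>UNIV. \<Sum>j\<in>UNIV. a i j *\<^sub>R (if i = k then 2 else 0) *\<^sub>R (f j :: 's))
    = (\<Sum>i\<in>UNIV. if i = k then \<Sum>j\<in>UNIV. (2 * a i j) *\<^sub>R f j else 0)"
    by (intro sum.cong refl) (auto intro!: sum.cong sum.neutral)
  then show ?thesis by (simp add: scaleR_sum_right)
qed

lemma sum_if_second:
  "(\<Sum>i\<in>UNIV. \<Sum>j\<in>UNIV. a i j *\<^sub>R (if j = k then 2 else 0) *\<^sub>R (f i :: 's))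
    = 2 *\<^sub>R (\<Sum>i\<in>UNIV. a (i::'n) (k::'n) *\<^sub>R f i)"
  by (subst sum.swap) (rule sum_if_first)

text \<open>Infinitesimal form of the equivariance \<open>S v = (A v) S\<close> of Clifford
  multiplication. Skewness makes the two contractions of \<open>\<gamma>_cycle\<close> add up to the
  factor 4 that cancels 1/4.\<close>

lemma spin_rep_\<gamma>:
  assumes "\<And>i j. a i j = - a j i"
  shows "spin_rep a (\<gamma> k s) = \<gamma> k (spin_rep a s) + (\<Sum>j\<in>UNIV. a k j *\<^sub>R \<gamma> j s)"
proof -
  have "(\<Sum>i\<in>UNIV. \<Sum>j\<in>UNIV. a i j *\<^sub>R \<gamma> i (\<gamma> j (\<gamma> k s)))
      = \<gamma> k (\<Sum>i\<in>UNIV. \<Sum>j\<in>UNIV. a i j *\<^sub>R \<gamma> i (\<gamma> j s))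
        + 2 *\<^sub>R (\<Sum>j\<in>UNIV. a k j *\<^sub>R \<gamma> j s) - 2 *\<^sub>R (\<Sum>i\<in>UNIV. a i k *\<^sub>R \<gamma> i s)"
    by (subst \<gamma>_cycle) (simp only: scaleR_diff_right scaleR_add_right sum.distrib sum_subtractf
        sum_if_first sum_if_second \<gamma>_simps)
  also have "(\<Sum>i\<in>UNIV. a i k *\<^sub>R \<gamma> i s) = - (\<Sum>j\<in>UNIV. a k j *\<^sub>R \<gamma> j s)"
    by (subst assms) (simp add: sum_negf)
  finally have "(\<Sum>i\<in>UNIV. \<Sum>j\<in>UNIV. a i j *\<^sub>R \<gamma> i (\<gamma> j (\<gamma> k s)))
      = \<gamma> k (\<Sum>i\<in>UNIV. \<Sum>j\<in>UNIV. a i j *\<^sub>R \<gamma> i (\<gamma> j s))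
        + 4 *\<^sub>R (\<Sum>j\<in>UNIV. a k j *\<^sub>R \<gamma> j s)"
    using scaleR_add_left[of 2 2 "\<Sum>j\<in>UNIV. a k j *\<^sub>R \<gamma> j s"] by simp
  then show ?thesis
    by (simp add: spin_rep_def linear_scale[OF linear_\<gamma>] scaleR_add_right)
qed

text \<open>The representation respects Lie brackets: by \<open>spin_rep_\<gamma>\<close>,
  \<open>spin_rep a\<close> acts as a derivation on both factors of
  \<open>\<gamma> k (\<gamma> l s)\<close>. Since \<open>a i j\<close> is the coefficient of the
  image of the \<open>i\<close>-th vector along the \<open>j\<close>-th, the matrix products appear
  in the order \<open>b a - a b\<close>.\<close>

lemma spin_rep_bracket:
  assumes "\<And>i j. a i j = - a j i"
  shows "spin_rep a (spin_rep b s) = spin_rep b (spin_rep a s)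
    + spin_rep (\<lambda>i j. \<Sum>m\<in>UNIV. b i m * a m j - a i m * b m j) s"
proof -
  have "(\<Sum>k\<in>UNIV. \<Sum>l\<in>UNIV. b k l *\<^sub>R spin_rep a (\<gamma> k (\<gamma> l s)))
     = (\<Sum>k\<in>UNIV. \<Sum>l\<in>UNIV. b k l *\<^sub>R \<gamma> k (\<gamma> l (spin_rep a s)))
     + (\<Sum>k\<in>UNIV. \<Sum>l\<in>UNIV. \<Sum>j\<in>UNIV. (b k l * a l j) *\<^sub>R \<gamma> k (\<gamma> j s))
     + (\<Sum>k\<in>UNIV. \<Sum>l\<in>UNIV. \<Sum>j\<in>UNIV. (b k l * a k j) *\<^sub>R \<gamma> j (\<gamma> l s))"
    by (simp add: spin_rep_\<gamma>[OF assms] \<gamma>_simps scaleR_add_right sum.distrib scaleR_sum_right)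
  also have "(\<Sum>k\<in>UNIV. \<Sum>l\<in>UNIV. \<Sum>j\<in>UNIV. (b k l * a l j) *\<^sub>R \<gamma> k (\<gamma> j s))
     = (\<Sum>i\<in>UNIV. \<Sum>j\<in>UNIV. (\<Sum>m\<in>UNIV. b i m * a m j) *\<^sub>R \<gamma> i (\<gamma> j s))"
    by (rule sum.cong[OF refl], subst sum.swap) (simp add: scaleR_sum_left)
  also have "(\<Sum>k\<in>UNIV. \<Sum>l\<in>UNIV. \<Sum>j\<in>UNIV. (b k l * a k j) *\<^sub>R \<gamma> j (\<gamma> l s))
     = - (\<Sum>i\<in>UNIV. \<Sum>j\<in>UNIV. (\<Sum>m\<in>UNIV. a i m * b m j) *\<^sub>R \<gamma> i (\<gamma> j s))"
    by (subst sum_rotate3, subst sum.swap, subst assms)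
       (simp add: scaleR_sum_left sum_negf mult.commute)
  finally show ?thesis
    by (simp add: spin_rep_def[of b] linear_scale[OF linear_spin_rep] linear_sum[OF linear_spin_rep])
       (simp add: spin_rep_def sum_subtractf scaleR_diff_left scaleR_diff_right scaleR_add_right)
qed

text \<open>Moving the last factor of \<open>\<gamma>\<^sub>k \<gamma>\<^sub>i \<gamma>\<^sub>j\<close> to the front once and twice turns the cyclic sum
  into three copies of the left-hand side, up to contractions.\<close>

lemma cubic_contraction:
  assumes skew: "\<And>k i j. T k i j = - T k j i"
    and cyclic: "\<And>k i j. T k i j + T i j k + T j k i = 0"
  shows "(\<Sum>k\<in>UNIV. \<Sum>i\<in>UNIV. \<Sum>j\<in>UNIV. T k i j *\<^sub>R \<gamma> k (\<gamma> i (\<gamma> j s)))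
    = - 2 *\<^sub>R (\<Sum>i\<in>UNIV. \<Sum>j\<in>UNIV. T i i j *\<^sub>R \<gamma> j s)"
proof -
  let ?S = "\<Sum>k\<in>UNIV. \<Sum>i\<in>UNIV. \<Sum>j\<in>UNIV. T k i j *\<^sub>R \<gamma> k (\<gamma> i (\<gamma> j s))"
  let ?Q = "\<Sum>i\<in>UNIV. \<Sum>j\<in>UNIV. T i i j *\<^sub>R \<gamma> j s"
  have Q': "(\<Sum>k\<in>UNIV. \<Sum>i\<in>UNIV. T k i k *\<^sub>R \<gamma> i s) = - ?Q"
    by (subst skew) (simp add: sum_negf)
  have T0: "T k i i = 0" for k i
    using skew[of k i i] by simp
  have 1: "(\<Sum>k\<in>UNIV. \<Sum>i\<in>UNIV. \<Sum>j\<in>UNIV. T k i j *\<^sub>R \<gamma> i (\<gamma> j (\<gamma> k s))) = ?S + 4 *\<^sub>R ?Q"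
  proof -
    have "(\<Sum>k\<in>UNIV. \<Sum>i\<in>UNIV. \<Sum>j\<in>UNIV. T k i j *\<^sub>R \<gamma> i (\<gamma> j (\<gamma> k s)))
      = ?S + 2 *\<^sub>R ?Q - 2 *\<^sub>R (\<Sum>k\<in>UNIV. \<Sum>i\<in>UNIV. T k i k *\<^sub>R \<gamma> i s)"
      by (subst \<gamma>_cycle) (simp only: scaleR_diff_right scaleR_add_right sum.distrib sum_subtractf
        sum_if_first sum_if_second scaleR_sum_right)
    then show ?thesis unfolding Q' using scaleR_add_left[of 2 2 ?Q] by simp
  qed
  have 2: "(\<Sum>k\<in>UNIV. \<Sum>i\<in>UNIV. \<Sum>j\<in>UNIV. T k i j *\<^sub>R \<gamma> j (\<gamma> k (\<gamma> i s))) = ?S + 2 *\<^sub>R ?Q"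
  proof -
    \<comment> \<open>The other contraction of \<open>\<gamma>_cycle\<close>, at
      \<open>i = j\<close>, is multiplied by \<open>T k i i = 0\<close>.\<close>
    have eq: "T k i j *\<^sub>R \<gamma> j (\<gamma> k (\<gamma> i s)) = T k i j *\<^sub>R \<gamma> k (\<gamma> i (\<gamma> j s))
        - T k i j *\<^sub>R (if j = k then 2 else 0) *\<^sub>R \<gamma> i s" for k i j
      using \<gamma>_cycle[of k i j s] by (cases "i = j") (auto simp: T0 scaleR_add_right scaleR_diff_right)
    have "(\<Sum>k\<in>UNIV. \<Sum>i\<in>UNIV. \<Sum>j\<in>UNIV. T k i j *\<^sub>R \<gamma> j (\<gamma> k (\<gamma> i s)))
      = ?S - 2 *\<^sub>R (\<Sum>k\<in>UNIV. \<Sum>i\<in>UNIV. T k i k *\<^sub>R \<gamma> i s)"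
      unfolding eq by (simp only: sum_subtractf sum_if_second scaleR_sum_right)
    then show ?thesis unfolding Q' by simp
  qed
  have "(\<Sum>k\<in>UNIV. \<Sum>i\<in>UNIV. \<Sum>j\<in>UNIV. (T k i j + T i j k + T j k i) *\<^sub>R \<gamma> k (\<gamma> i (\<gamma> j s))) = 0"
    by (simp add: cyclic)
  moreover have "(\<Sum>k\<in>UNIV. \<Sum>i\<in>UNIV. \<Sum>j\<in>UNIV. T i j k *\<^sub>R \<gamma> k (\<gamma> i (\<gamma> j s)))
    = (\<Sum>k\<in>UNIV. \<Sum>i\<in>UNIV. \<Sum>j\<in>UNIV. T k i j *\<^sub>R \<gamma> j (\<gamma> k (\<gamma> i s)))"
    by (rule sum_rotate3)
  moreover have "(\<Sum>k\<in>UNIV. \<Sum>i\<in>UNIV. \<Sum>j\<in>UNIV. T j k i *\<^sub>R \<gamma> k (\<gamma> i (\<gamma> j s)))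
    = (\<Sum>k\<in>UNIV. \<Sum>i\<in>UNIV. \<Sum>j\<in>UNIV. T k i j *\<^sub>R \<gamma> i (\<gamma> j (\<gamma> k s)))"
    by (rule sum_rotate3[symmetric])
  moreover have "3 *\<^sub>R x + 6 *\<^sub>R y = x + (x + 2 *\<^sub>R y) + (x + 4 *\<^sub>R y)" for x y :: 's
    using scaleR_add_left[of 2 1 x] scaleR_add_left[of 2 4 y] by (simp add: scaleR_2)
  ultimately have "3 *\<^sub>R ?S + 6 *\<^sub>R ?Q = 0"
    by (simp only: 1 2 scaleR_add_left sum.distrib)
  then have "3 *\<^sub>R (?S + 2 *\<^sub>R ?Q) = 0" by (simp add: scaleR_add_right)
  then have "?S + 2 *\<^sub>R ?Q = 0" by (simp only: scaleR_eq_0_iff) simp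
  then show ?thesis by (simp add: eq_neg_iff_add_eq_0)
qed

end

section \<open>The Levi-Civita connection in an orthonormal frame\<close>

text \<open>Nondegeneracy of the metric enters through the orthonormal frame, from which the inverse
  Gram matrix is built.\<close>

locale frame_chart = chart M c
  for M :: "('c, 'm::{t2_space, second_countable_topology}, 'n::finite, 'z) riemannian_scheme" and c +
  fixes e :: "'n \<Rightarrow> 'm \<Rightarrow> real ^ 'n"
  assumes C2_gram: "C2 (gram M c)"
    and C2_frame: "C2 (e i)"
    and ip_sym: "p \<in> cdom M c \<Longrightarrow> ip M c p v w = ip M c p w v"
    and orthonormal: "p \<in> cdom M c \<Longrightarrow> ip M c p (e i p) (e j p) = (if i = j then 1 else 0)"
begin

section \<open>Linear algebra of the metric in an orthonormal frame\<close>

lemma ip_sum: "ip M c p v w = (\<Sum>i\<in>UNIV. \<Sum>j\<in>UNIV. v $ i * (gram M c p $ i $ j * w $ j))"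
  by (simp add: ip_def inner_vec_def matrix_vector_mult_def sum_distrib_left)

lemma linear_ip_left: "linear (\<lambda>v. ip M c p v w)"
  by (rule linearI) (simp_all add: ip_def inner_add_left)

lemma linear_ip_right: "linear (\<lambda>w. ip M c p v w)"
  by (rule linearI) (simp_all add: ip_def matrix_vector_right_distrib inner_add_right
      matrix_vector_mult_scaleR)

lemmas ip_simps = linear_add[OF linear_ip_left] linear_add[OF linear_ip_right]
  linear_diff[OF linear_ip_left] linear_diff[OF linear_ip_right]
  linear_scale[OF linear_ip_left] linear_scale[OF linear_ip_right]
  linear_sum[OF linear_ip_left] linear_sum[OF linear_ip_right]
  linear_neg[OF linear_ip_left] linear_neg[OF linear_ip_right]
  linear_0[OF linear_ip_left] linear_0[OF linear_ip_right]

lemma gram_sym: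
  assumes "p \<in> cdom M c" shows "gram M c p $ i $ j = gram M c p $ j $ i"
proof -
  have "ip M c p (axis i 1) (axis j 1) = gram M c p $ i $ j" for i j
    by (simp add: ip_def inner_axis' matrix_vector_mult_basis column_def)
  then show ?thesis using ip_sym[OF assms] by metis
qed

text \<open>Orthonormality says that \<open>transpose E ** G ** E\<close> is the identity, with
  \<open>G\<close> the Gram matrix; one-sided inverses of square matrices are two-sided, so the
  factors may be permuted cyclically.\<close>

lemma frame_matrix:
  assumes "p \<in> cdom M c"
  defines "E \<equiv> \<chi> a i. e i p $ a"
  shows "E ** transpose E ** gram M c p = mat 1" "gram M c p ** (E ** transpose E) = mat 1"
proof -
  have "(transpose E ** gram M c p ** E) $ i $ j = ip M c p (e i p) (e j p)" for i j
    unfolding ip_sum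
    by (subst sum.swap) (simp add: matrix_matrix_mult_def transpose_def E_def sum_distrib_right mult.assoc)
  then have "transpose E ** gram M c p ** E = mat 1"
    using orthonormal[OF assms(1)] by (simp add: vec_eq_iff mat_def)
  then have "E ** (transpose E ** gram M c p) = mat 1"
    using matrix_left_right_inverse by blast
  then show "E ** transpose E ** gram M c p = mat 1"
    by (simp add: matrix_mul_assoc)
  then show "gram M c p ** (E ** transpose E) = mat 1"
    using matrix_left_right_inverse by blast
qed

lemma frame_expand:
  assumes "p \<in> cdom M c"
  shows "(\<Sum>i\<in>UNIV. ip M c p v (e i p) *\<^sub>R e i p) = v"
proof -
  let ?E = "\<chi> a i. e i p $ a"
  have "v = (?E ** transpose ?E ** gram M c p) *v v"
    by (simp add: frame_matrix[OF assms])
  also have "\<dots> = ?E *v (transpose ?E *v (gram M c p *v v))"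
    by (simp add: matrix_vector_mul_assoc matrix_mul_assoc)
  also have "transpose ?E *v (gram M c p *v v) = (\<chi> i. ip M c p v (e i p))"
    unfolding ip_sym[OF assms, of v]
    by (simp add: ip_def vec_eq_iff inner_vec_def vector_matrix_mult_def mult.commute)
  also have "?E *v \<dots> = (\<Sum>i\<in>UNIV. ip M c p v (e i p) *\<^sub>R e i p)"
    by (simp add: vec_eq_iff matrix_vector_mult_def mult.commute)
  finally show ?thesis ..
qed

text \<open>Makes the inverse metric a polynomial in the frame, so that Christoffel symbols and
  gradients can be differentiated without a rule for the derivative of an inverse matrix.\<close>

lemma matrix_inv_gram:
  assumes "p \<in> cdom M c"
  shows "matrix_inv (gram M c p) $ k $ l = (\<Sum>i\<in>UNIV. e i p $ k * e i p $ l)"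
proof -
  let ?E = "\<chi> a i. e i p $ a" and ?G = "gram M c p"
  have "?G ** matrix_inv ?G = mat 1 \<and> matrix_inv ?G ** ?G = mat 1"
    unfolding matrix_inv_def by (rule someI_ex) (use frame_matrix[OF assms] in blast)
  then have "matrix_inv ?G = ?E ** transpose ?E"
    using frame_matrix[OF assms] by (metis matrix_mul_assoc matrix_mul_lid matrix_mul_rid)
  then show ?thesis
    by (simp add: matrix_matrix_mult_def transpose_def)
qed

lemma ip_sharp:
  assumes "p \<in> cdom M c"
  shows "ip M c p (sharp M c p a) w = a \<bullet> w"
proof -
  have "sharp M c p a = (\<Sum>i\<in>UNIV. (a \<bullet> e i p) *\<^sub>R e i p)"
    by (simp add: vec_eq_iff sharp_def matrix_vector_mult_def matrix_inv_gram[OF assms] inner_vec_def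
        sum_distrib_left sum_distrib_right ac_simps) (subst sum.swap, simp)
  then have "ip M c p (sharp M c p a) w = a \<bullet> (\<Sum>i\<in>UNIV. ip M c p w (e i p) *\<^sub>R e i p)"
    by (simp add: ip_simps inner_sum_right ip_sym[OF assms, of w] mult.commute)
  then show ?thesis by (simp add: frame_expand[OF assms])
qed

lemma ip_frame_expand:
  assumes "p \<in> cdom M c"
  shows "ip M c p v w = (\<Sum>i\<in>UNIV. ip M c p v (e i p) * ip M c p w (e i p))"
  by (subst frame_expand[OF assms, of w, symmetric]) (simp add: ip_simps mult.commute)

text \<open>Basis independence of the trace. It connects the coordinate trace that defines
  \<open>Ric\<close> with the orthonormal trace that Clifford contraction produces.\<close>

lemma trace_frame:
  assumes "p \<in> cdom M c" "linear T"
  shows "(\<Sum>l\<in>UNIV. T (axis l 1) $ l) = (\<Sum>i\<in>UNIV. ip M c p (T (e i p)) (e i p))"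
proof -
  have "T (axis l 1) = (\<Sum>i\<in>UNIV. ip M c p (axis l 1) (e i p) *\<^sub>R T (e i p))" for l
    by (subst frame_expand[OF assms(1), of "axis l 1", symmetric])
       (simp add: linear_sum[OF assms(2)] linear_scale[OF assms(2)])
  then have "(\<Sum>l\<in>UNIV. T (axis l 1) $ l)
      = (\<Sum>i\<in>UNIV. \<Sum>l\<in>UNIV. T (e i p) $ l * ip M c p (axis l 1) (e i p))"
    by (simp add: mult.commute) (rule sum.swap)
  also have "\<dots> = (\<Sum>i\<in>UNIV. ip M c p (\<Sum>l\<in>UNIV. T (e i p) $ l *\<^sub>R axis l 1) (e i p))"
    by (simp add: ip_simps)
  also have "\<dots> = (\<Sum>i\<in>UNIV. ip M c p (T (e i p)) (e i p))"
    using basis_expansion[of "T (e _ p)"] by (simp add: scalar_mult_eq_scaleR)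
  finally show ?thesis .
qed

section \<open>The Levi-Civita connection: torsion-freeness and metric compatibility\<close>

definition Gam :: "'m \<Rightarrow> real ^ 'n \<Rightarrow> real ^ 'n \<Rightarrow> real ^ 'n" where
  "Gam p u v = (\<chi> k. \<Sum>i\<in>UNIV. \<Sum>j\<in>UNIV. christoffel M c k i j p * u $ i * v $ j)"

text \<open>The direction is one tangent vector instead of a field, so that linearity in it can be
  used at a point, for example with \<open>u\<close> expanded in the frame.\<close>

definition cov :: "real ^ 'n \<Rightarrow> ('m \<Rightarrow> real ^ 'n) \<Rightarrow> 'm \<Rightarrow> real ^ 'n" where
  "cov u Y p = dird M c u Y p + Gam p u (Y p)"

lemma nabla_cov: "nabla M c X Y p = cov (X p) Y p"
  by (simp add: nabla_def cov_def Gam_def)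

lemma linear_Gam_left: "linear (\<lambda>u. Gam p u v)"
  by (rule linearI) (simp_all add: Gam_def vec_eq_iff sum.distrib algebra_simps sum_distrib_left)

lemma linear_Gam_right: "linear (\<lambda>v. Gam p u v)"
  by (rule linearI) (simp_all add: Gam_def vec_eq_iff sum.distrib algebra_simps sum_distrib_left)

lemmas Gam_simps = linear_add[OF linear_Gam_left] linear_add[OF linear_Gam_right]
  linear_diff[OF linear_Gam_left] linear_diff[OF linear_Gam_right]
  linear_scale[OF linear_Gam_left] linear_scale[OF linear_Gam_right]

lemma linear_cov: "dif Y \<Longrightarrow> p \<in> cdom M c \<Longrightarrow> linear (\<lambda>u. cov u Y p)"
  unfolding cov_def by (intro linear_compose_add linear_dird linear_Gam_left)

lemma dif_gram: "dif (\<lambda>q. gram M c q $ i $ j)"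
  by (intro dif_nth C2_dif C2_gram)

lemma dif_frame: "dif (e i)"
  by (intro C2_dif C2_frame)

lemma dif_dird_gram: "dif (dird M c v (\<lambda>q. gram M c q $ i $ j))"
proof -
  have "dird M c v (\<lambda>q. gram M c q $ i $ j) p = dird M c v (gram M c) p $ i $ j" if "p \<in> cdom M c" for p
    using that by (simp add: dif_nth C2_dif C2_gram)
  then show ?thesis
    using dif_cong[of "dird M c v (\<lambda>q. gram M c q $ i $ j)" "\<lambda>q. dird M c v (gram M c) q $ i $ j"]
      dif_nth(1)[OF dif_nth(1)[OF dif_dird[OF C2_gram, of v], of i], of j] by simp
qed

lemma dif_christoffel: "dif (christoffel M c k i j)"
proof -
  have "dif (\<lambda>p. (\<Sum>l\<in>UNIV. (\<Sum>i\<in>UNIV. e i p $ k * e i p $ l) *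
        (dird M c (axis i 1) (\<lambda>q. gram M c q $ j $ l) p
         + dird M c (axis j 1) (\<lambda>q. gram M c q $ i $ l) p
         - dird M c (axis l 1) (\<lambda>q. gram M c q $ i $ j) p)) / 2)"
    by (intro dif_bounded_linear(1)[OF bounded_linear_divide] dif_sum finite dif_mult dif_add dif_diff
        dif_dird_gram dif_nth dif_frame)
  then show ?thesis
    by (subst dif_cong[of "christoffel M c k i j"]) (simp_all add: christoffel_def matrix_inv_gram)
qed

lemma dif_Gam: "dif X \<Longrightarrow> dif Y \<Longrightarrow> dif (\<lambda>q. Gam q (X q) (Y q))"
  unfolding Gam_def by (intro dif_vec dif_sum finite dif_mult dif_christoffel dif_nth)

lemma dif_cov: "dif X \<Longrightarrow> C2 Y \<Longrightarrow> dif (\<lambda>q. cov (X q) Y q)"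
  unfolding cov_def by (intro dif_add(1) dif_dird_field(1) dif_Gam) (auto intro: C2_dif)

lemma dif_ip: "dif X \<Longrightarrow> dif Y \<Longrightarrow> dif (\<lambda>q. ip M c q (X q) (Y q))"
  unfolding ip_sum by (intro dif_sum finite dif_mult dif_gram dif_nth)

lemma dird_Gam:
  assumes X: "dif X" and Y: "dif Y" and p: "p \<in> cdom M c"
  shows "dird M c u (\<lambda>q. Gam q (X q) (Y q)) p
    = dird M c u (\<lambda>q. Gam q (X p) (Y p)) p + Gam p (dird M c u X p) (Y p) + Gam p (X p) (dird M c u Y p)"
  unfolding Gam_def
  by (simp add: dif_vec dif_sum dif_mult dif_christoffel dif_nth X Y p vec_eq_iff
      sum.distrib[symmetric] algebra_simps)

lemma christoffel_sym: "p \<in> cdom M c \<Longrightarrow> christoffel M c k i j p = christoffel M c k j i p"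
  unfolding christoffel_def
  using dird_cong[of "\<lambda>q. gram M c q $ i $ j" "\<lambda>q. gram M c q $ j $ i" p] gram_sym
  by (simp add: add.commute)

text \<open>Torsion-freeness: with it the bracket of two fields is the difference of their covariant
  derivatives.\<close>

lemma Gam_sym: "p \<in> cdom M c \<Longrightarrow> Gam p u v = Gam p v u"
  unfolding Gam_def
  by (subst sum.swap) (simp add: vec_eq_iff christoffel_sym[of p _ _ _] ac_simps)

text \<open>Pairing with the metric cancels its inverse and leaves the Christoffel symbols of the
  first kind, as in the Koszul formula.\<close>

lemma ip_Gam:
  assumes p: "p \<in> cdom M c"
  shows "ip M c p (Gam p u v) w = (\<Sum>i\<in>UNIV. \<Sum>j\<in>UNIV. \<Sum>l\<in>UNIV. u $ i * v $ j * w $ l *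
    ((dird M c (axis i 1) (\<lambda>q. gram M c q $ j $ l) p
      + dird M c (axis j 1) (\<lambda>q. gram M c q $ i $ l) p
      - dird M c (axis l 1) (\<lambda>q. gram M c q $ i $ j) p) / 2))"
proof -
  let ?k = "\<lambda>i j. \<chi> l. (dird M c (axis i 1) (\<lambda>q. gram M c q $ j $ l) p
      + dird M c (axis j 1) (\<lambda>q. gram M c q $ i $ l) p
      - dird M c (axis l 1) (\<lambda>q. gram M c q $ i $ j) p) / 2"
  have "Gam p u v = (\<Sum>i\<in>UNIV. \<Sum>j\<in>UNIV. (u $ i * v $ j) *\<^sub>R sharp M c p (?k i j))"
    by (simp add: Gam_def vec_eq_iff christoffel_def sharp_def matrix_vector_mult_def sum_divide_distrib
        ac_simps)
  then have "ip M c p (Gam p u v) w = (\<Sum>i\<in>UNIV. \<Sum>j\<in>UNIV. u $ i * v $ j * (?k i j \<bullet> w))"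
    by (simp add: ip_simps ip_sharp[OF p])
  then show ?thesis by (simp add: inner_vec_def sum_distrib_left ac_simps)
qed

text \<open>Exchanging \<open>j\<close> and \<open>l\<close> in the first-kind symbol flips the sign
  of two of its three terms, by symmetry of the Gram matrix. In the sum only the derivative along
  \<open>u\<close> remains.\<close>

lemma metric_compatible:
  assumes p: "p \<in> cdom M c"
  shows "ip M c p (Gam p u v) w + ip M c p v (Gam p u w)
    = (\<Sum>j\<in>UNIV. \<Sum>l\<in>UNIV. v $ j * (dird M c u (\<lambda>q. gram M c q $ j $ l) p * w $ l))"
proof -
  let ?d = "\<lambda>i j l. dird M c (axis i 1) (\<lambda>q. gram M c q $ j $ l) p"
  have sym: "?d i j l = ?d i l j" for i j l
    by (rule dird_cong[OF gram_sym p])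
  have "ip M c p v (Gam p u w)
      = (\<Sum>i\<in>UNIV. \<Sum>j\<in>UNIV. \<Sum>l\<in>UNIV. u $ i * v $ j * w $ l * ((?d i j l + ?d l i j - ?d j i l) / 2))"
    by (subst ip_sym[OF p], subst ip_Gam[OF p], rule sum.cong[OF refl], subst sum.swap)
       (simp add: sym[of _ _ "_"] ac_simps)
  then have "ip M c p (Gam p u v) w + ip M c p v (Gam p u w)
      = (\<Sum>i\<in>UNIV. \<Sum>j\<in>UNIV. \<Sum>l\<in>UNIV. u $ i * v $ j * w $ l * ?d i j l)"
    unfolding ip_Gam[OF p] by (simp only: sum.distrib[symmetric], intro sum.cong refl) (simp add: field_simps)
  also have "\<dots> = (\<Sum>j\<in>UNIV. \<Sum>l\<in>UNIV. v $ j * ((\<Sum>i\<in>UNIV. u $ i *\<^sub>R ?d i j l) * w $ l))"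
    by (subst sum_rotate3) (simp add: sum_distrib_left sum_distrib_right ac_simps)
  finally show ?thesis by (simp only: dird_expand[OF dif_gram p, symmetric])
qed

lemma dird_ip:
  assumes Y: "dif Y" and Z: "dif Z" and p: "p \<in> cdom M c"
  shows "dird M c u (\<lambda>q. ip M c q (Y q) (Z q)) p
    = ip M c p (cov u Y p) (Z p) + ip M c p (Y p) (cov u Z p)"
proof -
  have "dird M c u (\<lambda>q. ip M c q (Y q) (Z q)) p
    = ip M c p (dird M c u Y p) (Z p) + ip M c p (Y p) (dird M c u Z p)
      + (\<Sum>j\<in>UNIV. \<Sum>l\<in>UNIV. Y p $ j * (dird M c u (\<lambda>q. gram M c q $ j $ l) p * Z p $ l))"
    unfolding ip_sum
    by (simp add: dif_sum dif_mult dif_gram dif_nth(1) Y Z p dif_nth(2)[OF Y p] dif_nth(2)[OF Z p]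
        sum.distrib[symmetric] algebra_simps)
  then show ?thesis
    unfolding cov_def ip_simps metric_compatible[OF p, symmetric] by simp
qed

end

section \<open>Curvature\<close>

text \<open>The octahedron argument: the Bianchi identities for the four cyclic shifts of
  \<open>a b c d\<close> combine linearly with the two skew symmetries.\<close>

lemma curvature_pair_symmetry:
  fixes K :: "'a \<Rightarrow> 'a \<Rightarrow> 'a \<Rightarrow> 'a \<Rightarrow> real"
  assumes skew1: "\<And>a b c d. K a b c d = - K b a c d"
    and skew2: "\<And>a b c d. K a b c d = - K a b d c"
    and bianchi: "\<And>a b c d. K a b c d + K b c a d + K c a b d = 0"
  shows "K a b c d = K c d a b"
  using bianchi[of a b c d] bianchi[of b c d a] bianchi[of c d a b] bianchi[of d a b c]
    skew1[of b d] skew1[of a c] skew1[of d a] skew1[of b c] skew1[of a b] skew1[of c d]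
    skew2[of _ _ a b] skew2[of _ _ c d] skew2[of _ _ b d] skew2[of _ _ a c] skew2[of _ _ a d]
    skew2[of _ _ b c]
  by (smt (verit))

context frame_chart
begin

text \<open>The curvature of fields with constant components, whose brackets vanish.\<close>

definition Rm :: "'m \<Rightarrow> real ^ 'n \<Rightarrow> real ^ 'n \<Rightarrow> real ^ 'n \<Rightarrow> real ^ 'n" where
  "Rm p u v w = dird M c u (\<lambda>q. Gam q v w) p - dird M c v (\<lambda>q. Gam q u w) p
     + Gam p u (Gam p v w) - Gam p v (Gam p u w)"

lemma nabla_nabla: "nabla M c V (nabla M c W Z) p = cov (V p) (\<lambda>q. cov (W q) Z q) p"
proof -
  have "nabla M c W Z = (\<lambda>q. cov (W q) Z q)"
    by (rule ext) (rule nabla_cov)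
  then show ?thesis by (simp add: nabla_cov)
qed

text \<open>Tensoriality of curvature. Second derivatives of \<open>Z\<close> cancel against the
  bracket by \<open>dird_lie_bracket\<close>, and the remaining first derivatives of the fields
  cancel in pairs or against the Christoffel term of the bracket.\<close>

lemma riem_curv_eq_Rm:
  assumes X: "dif X" and Y: "dif Y" and Z: "C2 Z" and p: "p \<in> cdom M c"
  shows "riem_curv M c X Y Z p = Rm p (X p) (Y p) (Z p)"
proof -
  note Z' = C2_dif[OF Z]
  have second: "nabla M c V (nabla M c W Z) p = dird M c (V p) (\<lambda>q. dird M c (W q) Z q) p
      + dird M c (V p) (\<lambda>q. Gam q (W p) (Z p)) p + Gam p (dird M c (V p) W p) (Z p)
      + Gam p (W p) (dird M c (V p) Z p)
      + Gam p (V p) (dird M c (W p) Z p) + Gam p (V p) (Gam p (W p) (Z p))"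
    if V: "dif V" and W: "dif W" for V W
    unfolding nabla_nabla cov_def
    by (simp add: dif_add(2)[OF dif_dird_field(1)[OF Z W] dif_Gam[OF W Z'] p] dird_Gam[OF W Z' p] Gam_simps)
  show ?thesis
    using dird_lie_bracket[OF Z X Y p]
    unfolding riem_curv_def second[OF X Y] second[OF Y X] Rm_def
      nabla_cov[of "lie_bracket M c X Y"] cov_def
    by (simp add: lie_bracket_def Gam_simps algebra_simps)
qed

lemma dif_Gam_const: "dif (\<lambda>q. Gam q u v)"
  using dif_Gam[of "\<lambda>q. u" "\<lambda>q. v"] by simp

lemma linear_dird_Gam_left:
  assumes p: "p \<in> cdom M c" shows "linear (\<lambda>v. dird M c u (\<lambda>q. Gam q v w) p)"
  by (rule linearI) (simp_all add: Gam_simps dif_add dif_scaleR_const dif_Gam_const p)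

lemma linear_dird_Gam_right:
  assumes p: "p \<in> cdom M c" shows "linear (\<lambda>w. dird M c u (\<lambda>q. Gam q v w) p)"
  by (rule linearI) (simp_all add: Gam_simps dif_add dif_scaleR_const dif_Gam_const p)

lemma linear_Rm:
  assumes p: "p \<in> cdom M c"
  shows "linear (\<lambda>u. Rm p u v w)" "linear (\<lambda>w. Rm p u v w)"
proof -
  note GG = linear_compose[OF linear_Gam_left linear_Gam_right, unfolded o_def]
    linear_compose[OF linear_Gam_right linear_Gam_right, unfolded o_def]
  show "linear (\<lambda>u. Rm p u v w)" "linear (\<lambda>w. Rm p u v w)"
    unfolding Rm_def
    by (intro linear_compose_add linear_compose_sub linear_dird dif_Gam_const p GG
        linear_dird_Gam_left linear_dird_Gam_right linear_Gam_left)+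
qed

lemma Rm_skew: "Rm p u v w = - Rm p v u w"
  by (simp add: Rm_def)

text \<open>Symmetry of \<open>Gam\<close> cancels the quadratic terms in pairs, and its derivative
  does the same for the differentiated ones.\<close>

lemma Rm_bianchi:
  assumes p: "p \<in> cdom M c"
  shows "Rm p u v w + Rm p v w u + Rm p w u v = 0"
proof -
  have "dird M c a (\<lambda>q. Gam q b d) p = dird M c a (\<lambda>q. Gam q d b) p" for a b d
    by (rule dird_cong[OF Gam_sym p])
  note this[of u v w] this[of v w u] this[of w u v]
  then show ?thesis
    by (simp add: Rm_def Gam_sym[OF p, of v w] Gam_sym[OF p, of w u] Gam_sym[OF p, of u v])
qed

section \<open>Connection and curvature forms of the frame, and the symmetries of the
  curvature\<close>

definition conn_form :: "'n \<Rightarrow> 'n \<Rightarrow> real ^ 'n \<Rightarrow> 'm \<Rightarrow> real" where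
  "conn_form i j u p = ip M c p (cov u (e i) p) (e j p)"

lemma linear_conn_form: "p \<in> cdom M c \<Longrightarrow> linear (\<lambda>u. conn_form i j u p)"
  unfolding conn_form_def
  by (rule linearI) (simp_all add: linear_add[OF linear_cov[OF dif_frame]]
      linear_scale[OF linear_cov[OF dif_frame]] ip_simps)

text \<open>Differentiate the constant inner products of the frame vectors.\<close>

lemma conn_form_skew:
  assumes p: "p \<in> cdom M c" shows "conn_form i j u p = - conn_form j i u p"
proof -
  have "dird M c u (\<lambda>q. ip M c q (e i q) (e j q)) p = dird M c u (\<lambda>q. if i = j then 1 else 0) p"
    by (rule dird_cong[OF orthonormal p])
  then show ?thesis
    by (simp add: dird_ip[OF dif_frame dif_frame p] conn_form_def ip_sym[OF p, of "e i p"])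
qed

lemma dif_conn_form: "dif X \<Longrightarrow> dif (\<lambda>q. conn_form i j (X q) q)"
  unfolding conn_form_def by (intro dif_ip dif_cov C2_frame dif_frame)

definition curv_form :: "('m \<Rightarrow> real ^ 'n) \<Rightarrow> ('m \<Rightarrow> real ^ 'n) \<Rightarrow> 'n \<Rightarrow> 'n \<Rightarrow> 'm \<Rightarrow> real" where
  "curv_form X Y i j p = ip M c p (riem_curv M c X Y (e i) p) (e j p)"

text \<open>Cartan's second structure equation. Metric compatibility moves the outer derivative off
  the inner product; the leftover product of two covariant derivatives of frame vectors, expanded in
  the frame, is the quadratic term.\<close>

lemma structure_equation:
  assumes X: "dif X" and Y: "dif Y" and p: "p \<in> cdom M c"
  shows "curv_form X Y i k p
    = dird M c (X p) (\<lambda>q. conn_form i k (Y q) q) p - dird M c (Y p) (\<lambda>q. conn_form i k (X q) q) p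
      - conn_form i k (lie_bracket M c X Y p) p
      + (\<Sum>j\<in>UNIV. conn_form i j (Y p) p * conn_form j k (X p) p
           - conn_form i j (X p) p * conn_form j k (Y p) p)"
proof -
  have second: "ip M c p (nabla M c V (nabla M c W (e i)) p) (e k p)
      = dird M c (V p) (\<lambda>q. conn_form i k (W q) q) p
        + (\<Sum>j\<in>UNIV. conn_form i j (W p) p * conn_form j k (V p) p)"
    if W: "dif W" for V W
  proof -
    have "ip M c p (cov (W p) (e i) p) (cov (V p) (e k) p)
        = - (\<Sum>j\<in>UNIV. conn_form i j (W p) p * conn_form j k (V p) p)"
      unfolding conn_form_skew[OF p, of _ k]
      by (subst ip_frame_expand[OF p]) (simp add: conn_form_def sum_negf)
    then show ?thesis
      using dird_ip[OF dif_cov[OF W C2_frame] dif_frame p, of "V p" i k]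
      unfolding conn_form_def nabla_nabla by simp
  qed
  have "ip M c p (nabla M c (lie_bracket M c X Y) (e i) p) (e k p) = conn_form i k (lie_bracket M c X Y p) p"
    by (simp only: nabla_cov conn_form_def)
  then show ?thesis
    using second[OF Y, of X] second[OF X, of Y]
    by (simp only: curv_form_def riem_curv_def linear_diff[OF linear_ip_left] sum_subtractf)
qed

text \<open>In the structure equation the derivatives of skew forms are skew, and so is the
  commutator of two skew matrices.\<close>

lemma curv_form_skew:
  assumes X: "dif X" and Y: "dif Y" and p: "p \<in> cdom M c"
  shows "curv_form X Y i k p = - curv_form X Y k i p"
proof -
  have dird_skew: "dird M c u (\<lambda>q. conn_form i k (V q) q) p = - dird M c u (\<lambda>q. conn_form k i (V q) q) p"
    if "dif V" for u V
  proof -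
    have "dird M c u (\<lambda>q. conn_form i k (V q) q) p = dird M c u (\<lambda>q. - conn_form k i (V q) q) p"
      using p by (intro dird_cong conn_form_skew)
    then show ?thesis
      using dif_minus(2)[OF dif_conn_form[OF that] p] by simp
  qed
  have "(\<Sum>j\<in>UNIV. conn_form k j (Y p) p * conn_form j i (X p) p
           - conn_form k j (X p) p * conn_form j i (Y p) p)
      = - (\<Sum>j\<in>UNIV. conn_form i j (Y p) p * conn_form j k (X p) p
           - conn_form i j (X p) p * conn_form j k (Y p) p)"
    unfolding conn_form_skew[OF p, of k] conn_form_skew[OF p, of _ i]
    by (simp add: sum_negf[symmetric] mult.commute)
  then show ?thesis
    unfolding structure_equation[OF X Y p] dird_skew[OF X] dird_skew[OF Y] conn_form_skew[OF p, of i k]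
    by simp
qed

text \<open>Both sides are bilinear in \<open>w\<close> and \<open>z\<close>, and on frame vectors
  the claim is \<open>curv_form_skew\<close> for the constant fields \<open>u\<close> and
  \<open>v\<close>.\<close>

lemma ip_Rm_skew:
  assumes p: "p \<in> cdom M c"
  shows "ip M c p (Rm p u v w) z = - ip M c p (Rm p u v z) w"
proof -
  let ?B = "\<lambda>w z. ip M c p (Rm p u v w) z"
  have frame: "?B (e i p) (e k p) = - ?B (e k p) (e i p)" for i k
    using curv_form_skew[of "\<lambda>q. u" "\<lambda>q. v" p i k] p
    by (simp add: curv_form_def riem_curv_eq_Rm C2_frame)
  have expand: "?B w z = (\<Sum>i\<in>UNIV. \<Sum>k\<in>UNIV. ip M c p w (e i p) * ip M c p z (e k p) * ?B (e i p) (e k p))"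
    for w z
  proof -
    have "?B w z = ?B (\<Sum>i\<in>UNIV. ip M c p w (e i p) *\<^sub>R e i p) (\<Sum>k\<in>UNIV. ip M c p z (e k p) *\<^sub>R e k p)"
      by (simp only: frame_expand[OF p])
    then show ?thesis
      by (simp add: linear_sum[OF linear_Rm(2)[OF p]] linear_scale[OF linear_Rm(2)[OF p]] ip_simps
          sum_distrib_left mult.assoc) (subst sum.swap, simp add: mult.left_commute)
  qed
  show ?thesis
    unfolding expand[of w z] expand[of z w]
    by (subst sum.swap, subst frame) (simp add: sum_negf mult.commute)
qed

text \<open>Pair symmetry moves the fixed vector \<open>x\<close> from the second slot to the last,
  where the sum becomes the first Bianchi identity. This supplies the cyclic hypothesis of
  \<open>cubic_contraction\<close>.\<close>

lemma ip_Rm_cyclic: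
  assumes p: "p \<in> cdom M c"
  shows "ip M c p (Rm p a x b) d + ip M c p (Rm p b x d) a + ip M c p (Rm p d x a) b = 0"
proof -
  let ?K = "\<lambda>a b w z. ip M c p (Rm p a b w) z"
  have bianchi: "?K a b w z + ?K b w a z + ?K w a b z = 0" for a b w z
    using arg_cong[OF Rm_bianchi[OF p, of a b w], of "\<lambda>x. ip M c p x z"]
    by (simp only: ip_simps)
  have pair: "?K a b w z = ?K w z a b" for a b w z
  proof (rule curvature_pair_symmetry[where K="?K"])
    show "?K a b w z = - ?K b a w z" for a b w z
      by (subst Rm_skew) (simp add: ip_simps)
    show "?K a b w z = - ?K a b z w" for a b w z
      by (rule ip_Rm_skew[OF p])
    show "?K a b w z + ?K b w a z + ?K w a b z = 0" for a b w z
      by (rule bianchi)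
  qed
  show ?thesis
    using pair[of a x b d] pair[of b x d a] pair[of d x a b] bianchi[of b d a x] by simp
qed

lemma Ric_eq_frame:
  assumes X: "dif X" and Z: "C2 Z" and p: "p \<in> cdom M c"
  shows "Ric M c X Z p = (\<Sum>i\<in>UNIV. ip M c p (Rm p (e i p) (X p) (Z p)) (e i p))"
  using trace_frame[OF p linear_Rm(1)[OF p], of "X p" "Z p"]
  by (simp add: Ric_def coord_field_def riem_curv_eq_Rm[OF _ X Z p])

end

section \<open>The spinor bundle over a chart\<close>

lemma linear_functional_inner:
  fixes r :: "real ^ 'n::finite \<Rightarrow> real"
  assumes "linear r" shows "(\<chi> k. r (axis k 1)) \<bullet> z = r z"
proof -
  have "r z = r (\<Sum>k\<in>UNIV. z $ k *\<^sub>R axis k 1)"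
    using basis_expansion[of z] by (simp add: scalar_mult_eq_scaleR)
  also have "\<dots> = (\<Sum>k\<in>UNIV. z $ k * r (axis k 1))"
    by (simp add: linear_sum[OF assms] linear_scale[OF assms])
  finally show ?thesis by (simp add: inner_vec_def mult.commute)
qed

lemma scaleR_matrix_vector: "(r *\<^sub>R A) *v s = r *\<^sub>R (A *v s)"
  for A :: "complex ^ 'k ^ 'j"
  by (simp add: vec_eq_iff matrix_vector_mult_def scaleR_sum_right)

lemma sum_matrix_vector: "(\<Sum>i\<in>I. A i) *v s = (\<Sum>i\<in>I. A i *v s)"
  for A :: "'i \<Rightarrow> complex ^ 'k ^ 'j"
  by (induction I rule: infinite_finite_induct) (simp_all add: matrix_vector_mult_add_rdistrib)

locale spin_chart =
  fixes M :: "('c, 'm::{t2_space, second_countable_topology}, 'n::finite, 'k::finite, 'z) spin_manifold_scheme"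
    and c :: 'c
  assumes spin_manifold: "complete_riemannian_spin_manifold M"
begin

sublocale chart M c
  using spin_manifold by unfold_locales (simp add: complete_riemannian_spin_manifold_def)

sublocale frame_chart M c "frm M c"
  using spin_manifold
  by unfold_locales
     (auto simp: complete_riemannian_spin_manifold_def riemannian_metric_def oriented_frames_def
       intro!: C2_if_smooth)

sublocale clifford_module "\<lambda>i s. gam M i *v s"
proof (rule clifford_module.intro)
  show "linear ((*v) (gam M i))" for i
    by simp
  fix i j and s :: "complex ^ 'k"
  have "gam M i ** gam M j + gam M j ** gam M i = mat (if i = j then - 2 else 0)"
    using spin_manifold by (simp add: complete_riemannian_spin_manifold_def spin_module_def)
  then have "(gam M i ** gam M j + gam M j ** gam M i) *v s = mat (if i = j then - 2 else 0) *v s"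
    by simp
  moreover have "mat a *v s = a *s s" for a :: complex
    by (simp add: vec_eq_iff matrix_vector_mult_def mat_def if_distrib[of "\<lambda>x. x * _"] cong: if_cong)
  ultimately show "gam M i *v (gam M j *v s) + gam M j *v (gam M i *v s) = (if i = j then - 2 else 0) *\<^sub>R s"
    by (simp add: matrix_vector_mult_add_rdistrib matrix_vector_mul_assoc vec_eq_iff scaleR_conv_of_real)
qed

abbreviation e :: "'n \<Rightarrow> 'm \<Rightarrow> real ^ 'n" where "e \<equiv> frm M c"
abbreviation \<gamma> :: "'n \<Rightarrow> complex ^ 'k \<Rightarrow> complex ^ 'k" where "\<gamma> i s \<equiv> gam M i *v s"

lemma clmul_sum: "clmul M c p v s = (\<Sum>i\<in>UNIV. ip M c p v (e i p) *\<^sub>R \<gamma> i s)"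
  by (simp add: clmul_def cliff_vec_def sum_matrix_vector scaleR_matrix_vector)

lemma clmul_frame:
  assumes "p \<in> cdom M c" shows "clmul M c p (e i p) s = \<gamma> i s"
proof -
  have "clmul M c p (e i p) s = (\<Sum>j\<in>UNIV. if j = i then \<gamma> j s else 0)"
    unfolding clmul_sum by (intro sum.cong refl) (auto simp: orthonormal[OF assms])
  then show ?thesis by simp
qed

lemma linear_clmul_right: "linear (clmul M c p v)"
  by (rule linearI) (simp_all add: clmul_sum \<gamma>_simps scaleR_add_right sum.distrib scaleR_sum_right ac_simps)

section \<open>The spinor connection: curvature and the Leibniz rule\<close>

definition scov :: "real ^ 'n \<Rightarrow> ('m \<Rightarrow> complex ^ 'k) \<Rightarrow> 'm \<Rightarrow> complex ^ 'k" where
  "scov u \<psi> p = dird M c u \<psi> p + spin_rep (\<lambda>i j. conn_form i j u p) (\<psi> p)"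

lemma spin_nabla_scov:
  "p \<in> cdom M c \<Longrightarrow> spin_nabla M c X \<psi> p = scov (X p) \<psi> p"
  by (simp add: spin_nabla_def scov_def spin_rep_def conn_form_def nabla_cov clmul_frame)

lemma scov_cong:
  assumes "\<And>q. q \<in> cdom M c \<Longrightarrow> \<phi> q = \<psi> q" "p \<in> cdom M c"
  shows "scov u \<phi> p = scov u \<psi> p"
  using dird_cong[of \<phi> \<psi> p u] assms by (simp add: scov_def)

lemma linear_scov:
  assumes "dif \<psi>" "p \<in> cdom M c" shows "linear (\<lambda>u. scov u \<psi> p)"
proof -
  note lin = linear_conn_form[OF assms(2)] and lin' = linear_dird[OF assms]
  show ?thesis
    by (rule linearI)
       (simp_all add: scov_def spin_rep_def linear_add[OF lin] linear_scale[OF lin] linear_add[OF lin']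
         linear_scale[OF lin'] scaleR_add_left sum.distrib scaleR_add_right scaleR_sum_right ac_simps)
qed

lemma scov_diff:
  "dif \<phi> \<Longrightarrow> dif \<psi> \<Longrightarrow> p \<in> cdom M c \<Longrightarrow> scov u (\<lambda>q. \<phi> q - \<psi> q) p = scov u \<phi> p - scov u \<psi> p"
  by (simp add: scov_def dif_diff linear_diff[OF linear_spin_rep])

lemma scov_scaleR:
  "dif \<psi> \<Longrightarrow> p \<in> cdom M c \<Longrightarrow> scov u (\<lambda>q. r *\<^sub>R \<psi> q) p = r *\<^sub>R scov u \<psi> p"
  by (simp add: scov_def dif_scaleR_const linear_scale[OF linear_spin_rep] scaleR_add_right)

lemma scov_sum:
  "finite I \<Longrightarrow> (\<And>i. i \<in> I \<Longrightarrow> dif (F i)) \<Longrightarrow> p \<in> cdom M c \<Longrightarrow>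
    scov u (\<lambda>q. \<Sum>i\<in>I. F i q) p = (\<Sum>i\<in>I. scov u (F i) p)"
  by (simp add: scov_def dif_sum linear_sum[OF linear_spin_rep] sum.distrib)

lemmas dif_\<gamma> = dif_bounded_linear[OF matrix_vector_mul_bounded_linear]

lemma dif_spin_rep:
  assumes a: "\<And>i j. dif (a i j)" and s: "dif s"
  shows "dif (\<lambda>q. spin_rep (\<lambda>i j. a i j q) (s q))"
    and "p \<in> cdom M c \<Longrightarrow> dird M c u (\<lambda>q. spin_rep (\<lambda>i j. a i j q) (s q)) p
      = spin_rep (\<lambda>i j. dird M c u (a i j) p) (s p) + spin_rep (\<lambda>i j. a i j p) (dird M c u s p)"
proof -
  show "dif (\<lambda>q. spin_rep (\<lambda>i j. a i j q) (s q))"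
    unfolding spin_rep_def by (intro dif_scaleR_const dif_sum finite dif_scaleR a dif_\<gamma> s)
  assume p: "p \<in> cdom M c"
  show "dird M c u (\<lambda>q. spin_rep (\<lambda>i j. a i j q) (s q)) p
      = spin_rep (\<lambda>i j. dird M c u (a i j) p) (s p) + spin_rep (\<lambda>i j. a i j p) (dird M c u s p)"
    unfolding spin_rep_def
    by (simp add: dif_scaleR_const dif_sum dif_scaleR a dif_\<gamma> s p sum.distrib scaleR_add_right add.commute)
qed

lemma dif_scov: "C2 \<psi> \<Longrightarrow> dif X \<Longrightarrow> dif (\<lambda>q. scov (X q) \<psi> q)"
  unfolding scov_def
  by (intro dif_add(1) dif_dird_field(1) dif_spin_rep(1) dif_conn_form) (auto intro: C2_dif)

lemma dif_clmul: "dif Y \<Longrightarrow> dif s \<Longrightarrow> dif (\<lambda>q. clmul M c q (Y q) (s q))"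
  unfolding clmul_sum by (intro dif_sum finite dif_scaleR dif_ip dif_frame dif_\<gamma>)

text \<open>The terms with one derivative on \<open>\<psi>\<close> and one connection form are
  symmetric in \<open>X\<close> and \<open>Y\<close> and drop out. Derivatives of the forms and the
  bracket from \<open>spin_rep_bracket\<close> together give the structure equation.\<close>

lemma spin_curvature:
  assumes \<psi>: "C2 \<psi>" and X: "dif X" and Y: "dif Y" and p: "p \<in> cdom M c"
  shows "scov (Y p) (\<lambda>q. scov (X q) \<psi> q) p - scov (X p) (\<lambda>q. scov (Y q) \<psi> q) p
      - scov (lie_bracket M c Y X p) \<psi> p
    = spin_rep (\<lambda>i j. curv_form Y X i j p) (\<psi> p)"
proof -
  let ?w = "\<lambda>X p i j. conn_form i j (X p) p"
  have second: "scov u (\<lambda>q. scov (X q) \<psi> q) p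
      = dird M c u (\<lambda>q. dird M c (X q) \<psi> q) p + spin_rep (\<lambda>i j. dird M c u (\<lambda>q. conn_form i j (X q) q) p) (\<psi> p)
        + spin_rep (?w X p) (dird M c u \<psi> p)
        + spin_rep (\<lambda>i j. conn_form i j u p) (dird M c (X p) \<psi> p)
        + spin_rep (\<lambda>i j. conn_form i j u p) (spin_rep (?w X p) (\<psi> p))"
    if X: "dif X" for X u
    unfolding scov_def
    by (simp add: dif_add(2)[OF dif_dird_field(1)[OF \<psi> X] dif_spin_rep(1)[OF dif_conn_form[OF X] C2_dif[OF \<psi>]] p]
        dif_spin_rep(2)[OF dif_conn_form[OF X] C2_dif[OF \<psi>] p] linear_add[OF linear_spin_rep])
  show ?thesis
    unfolding second[OF X] second[OF Y] structure_equation[OF Y X p] spin_rep_add spin_rep_diff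
      scov_def[of "lie_bracket M c Y X p"]
    using dird_lie_bracket[OF \<psi> Y X p]
      spin_rep_bracket[of "?w Y p" "?w X p" "\<psi> p", OF conn_form_skew[OF p]]
    by (simp add: algebra_simps)
qed

text \<open>Differentiating the frame components of \<open>Y\<close> yields an unwanted term with
  the derivatives of the frame; commuting the connection form past Clifford multiplication by
  \<open>spin_rep_\<gamma>\<close> yields its negative.\<close>

lemma scov_clmul:
  assumes Y: "dif Y" and s: "dif s" and p: "p \<in> cdom M c"
  shows "scov u (\<lambda>q. clmul M c q (Y q) (s q)) p
    = clmul M c p (cov u Y p) (s p) + clmul M c p (Y p) (scov u s p)"
proof -
  let ?w = "\<lambda>i j. conn_form i j u p" and ?y = "\<lambda>i. ip M c p (Y p) (e i p)"
  have "dird M c u (\<lambda>q. clmul M c q (Y q) (s q)) p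
      = clmul M c p (Y p) (dird M c u s p) + clmul M c p (cov u Y p) (s p)
        + (\<Sum>i\<in>UNIV. ip M c p (Y p) (cov u (e i) p) *\<^sub>R \<gamma> i (s p))"
    unfolding clmul_sum
    by (simp add: dif_sum dif_scaleR dif_ip dif_frame dif_\<gamma> Y s p dird_ip[OF Y dif_frame p]
        scaleR_add_left sum.distrib)
  moreover have "(\<Sum>i\<in>UNIV. ip M c p (Y p) (cov u (e i) p) *\<^sub>R \<gamma> i (s p))
      = (\<Sum>i\<in>UNIV. \<Sum>j\<in>UNIV. (?w i j * ?y j) *\<^sub>R \<gamma> i (s p))"
    by (subst ip_sym[OF p], subst ip_frame_expand[OF p])
       (simp add: conn_form_def scaleR_sum_left)
  moreover have "spin_rep ?w (clmul M c p (Y p) (s p))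
      = clmul M c p (Y p) (spin_rep ?w (s p)) + (\<Sum>i\<in>UNIV. \<Sum>j\<in>UNIV. (?y i * ?w i j) *\<^sub>R \<gamma> j (s p))"
    unfolding clmul_sum
    by (simp add: linear_sum[OF linear_spin_rep] linear_scale[OF linear_spin_rep]
        spin_rep_\<gamma>[of ?w, OF conn_form_skew[OF p]] scaleR_add_right sum.distrib scaleR_sum_right)
  moreover have "(\<Sum>i\<in>UNIV. \<Sum>j\<in>UNIV. (?y i * ?w i j) *\<^sub>R \<gamma> j (s p))
      = - (\<Sum>i\<in>UNIV. \<Sum>j\<in>UNIV. (?w i j * ?y j) *\<^sub>R \<gamma> i (s p))"
    by (subst sum.swap, subst conn_form_skew[OF p]) (simp add: sum_negf mult.commute)
  ultimately show ?thesis
    by (simp add: scov_def linear_add[OF linear_clmul_right])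
qed

lemma dirac_scov:
  "p \<in> cdom M c \<Longrightarrow> dirac M c \<psi> p = (\<Sum>i\<in>UNIV. clmul M c p (e i p) (scov (e i p) \<psi> p))"
  by (simp add: dirac_def spin_nabla_scov)

text \<open>The connection forms of the frame enter \<open>\<Sum>\<^sub>i (\<nabla>\<^sub>u e\<^sub>i) \<cdot> \<nabla>\<^bsub>e_i\<^esub> \<psi>\<close> and
  \<open>\<Sum>\<^sub>i e\<^sub>i \<cdot> \<nabla>\<^bsub>\<nabla>_u e_i\<^esub> \<psi>\<close> with transposed indices.\<close>

lemma frame_rotation_cancels:
  assumes \<psi>: "dif \<psi>" and p: "p \<in> cdom M c"
  shows "(\<Sum>i\<in>UNIV. clmul M c p (cov u (e i) p) (scov (e i p) \<psi> p))
    = - (\<Sum>i\<in>UNIV. clmul M c p (e i p) (scov (cov u (e i) p) \<psi> p))"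
proof -
  let ?w = "\<lambda>i j. conn_form i j u p"
  have "cov u (e i) p = (\<Sum>j\<in>UNIV. ?w i j *\<^sub>R e j p)" for i
    by (simp only: conn_form_def frame_expand[OF p])
  then have "clmul M c p (e i p) (scov (cov u (e i) p) \<psi> p) = (\<Sum>j\<in>UNIV. ?w i j *\<^sub>R \<gamma> i (scov (e j p) \<psi> p))" for i
    by (simp add: clmul_frame[OF p] linear_sum[OF linear_scov[OF \<psi> p]] linear_scale[OF linear_scov[OF \<psi> p]] \<gamma>_simps)
  moreover have "clmul M c p (cov u (e i) p) (scov (e i p) \<psi> p) = (\<Sum>j\<in>UNIV. ?w i j *\<^sub>R \<gamma> j (scov (e i p) \<psi> p))" for i
    by (simp add: clmul_sum conn_form_def)
  moreover have "(\<Sum>i\<in>UNIV. \<Sum>j\<in>UNIV. ?w i j *\<^sub>R \<gamma> j (scov (e i p) \<psi> p))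
      = - (\<Sum>i\<in>UNIV. \<Sum>j\<in>UNIV. ?w i j *\<^sub>R \<gamma> i (scov (e j p) \<psi> p))"
    by (subst sum.swap, subst conn_form_skew[OF p]) (simp add: sum_negf)
  ultimately show ?thesis by simp
qed

text \<open>The cubic contraction with \<open>T k i j\<close> the curvature form of the pair
  \<open>e k\<close>, \<open>X\<close>. Its constant -2 times 1/4, with the sign from interchanging
  the last two indices, is 1/2, and the coefficient left over is the Ricci trace.\<close>

lemma clifford_trace_curvature:
  assumes X: "dif X" and p: "p \<in> cdom M c"
  shows "(\<Sum>k\<in>UNIV. \<gamma> k (spin_rep (\<lambda>i j. curv_form (e k) X i j p) s))
    = (1 / 2) *\<^sub>R (\<Sum>j\<in>UNIV. (\<Sum>i\<in>UNIV. ip M c p (Rm p (e i p) (X p) (e j p)) (e i p)) *\<^sub>R \<gamma> j s)"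
proof -
  let ?T = "\<lambda>k i j. curv_form (e k) X i j p"
  have T: "?T k i j = ip M c p (Rm p (e k p) (X p) (e i p)) (e j p)" for k i j
    by (simp add: curv_form_def riem_curv_eq_Rm dif_frame X C2_frame p)
  have skew: "?T k i j = - ?T k j i" for k i j
    by (rule curv_form_skew[OF dif_frame X p])
  have "?T k i j + ?T i j k + ?T j k i = 0" for k i j
    unfolding T by (rule ip_Rm_cyclic[OF p])
  then have "(\<Sum>k\<in>UNIV. \<gamma> k (spin_rep (?T k) s)) = (1 / 4) *\<^sub>R - 2 *\<^sub>R (\<Sum>i\<in>UNIV. \<Sum>j\<in>UNIV. ?T i i j *\<^sub>R \<gamma> j s)"
    by (subst cubic_contraction[of ?T, OF skew, symmetric])
       (simp_all add: spin_rep_def \<gamma>_simps scaleR_sum_right)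
  also have "(\<Sum>i\<in>UNIV. \<Sum>j\<in>UNIV. ?T i i j *\<^sub>R \<gamma> j s) = - (\<Sum>j\<in>UNIV. (\<Sum>i\<in>UNIV. ?T i j i) *\<^sub>R \<gamma> j s)"
    by (subst sum.swap, subst skew) (simp add: sum_negf scaleR_sum_left)
  finally show ?thesis by (simp add: T)
qed

section \<open>Gradient, Hessian and the endomorphism of the weighted Ricci tensor\<close>

lemma clmul_sharp:
  "p \<in> cdom M c \<Longrightarrow> clmul M c p (sharp M c p a) s = (\<Sum>j\<in>UNIV. (a \<bullet> e j p) *\<^sub>R \<gamma> j s)"
  by (simp add: clmul_sum ip_sharp)

lemma ip_grad:
  assumes "dif f" "p \<in> cdom M c" shows "ip M c p (grad M f c p) w = dird M c w f p"
  unfolding grad_def ip_sharp[OF assms(2)] by (rule linear_functional_inner[OF linear_dird[OF assms]])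

lemma dif_grad:
  assumes "C2 f" shows "dif (grad M f c)"
proof -
  have "dif (\<lambda>q. \<chi> k. \<Sum>l\<in>UNIV. (\<Sum>i\<in>UNIV. e i q $ k * e i q $ l) * dird M c (axis l 1) f q)"
    by (intro dif_vec dif_sum finite dif_mult dif_nth dif_frame dif_dird assms)
  then show ?thesis
    by (subst dif_cong[of "grad M f c"])
       (simp_all add: grad_def sharp_def vec_eq_iff matrix_vector_mult_def matrix_inv_gram)
qed

text \<open>Differentiate the pairing of the gradient with a coordinate field by metric
  compatibility: the term with the covariant derivative of that field is the correction in
  \<open>Hess\<close>.\<close>

lemma Hess_eq_cov_grad:
  assumes f: "C2 f" and p: "p \<in> cdom M c"
  shows "Hess M f c X (coord_field k) p = ip M c p (cov (X p) (grad M f c) p) (axis k 1)"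
proof -
  have "dird M c (X p) (\<lambda>q. dird M c (axis k 1) f q) p
      = dird M c (X p) (\<lambda>q. ip M c q (grad M f c q) (axis k 1)) p"
    by (rule dird_cong[OF _ p]) (simp add: ip_grad C2_dif[OF f])
  also have "\<dots> = ip M c p (cov (X p) (grad M f c) p) (axis k 1)
      + ip M c p (grad M f c p) (cov (X p) (\<lambda>q. axis k 1) p)"
    by (rule dird_ip[OF dif_grad[OF f] dif_const p])
  finally show ?thesis
    by (simp add: Hess_def coord_field_def nabla_cov ip_grad[OF C2_dif[OF f] p])
qed

lemma clmul_Ric_f_endo:
  assumes f: "C2 f" and X: "dif X" and p: "p \<in> cdom M c"
  shows "clmul M c p (Ric_f_endo M f c X p) s
    = (\<Sum>j\<in>UNIV. (\<Sum>i\<in>UNIV. ip M c p (Rm p (e i p) (X p) (e j p)) (e i p)) *\<^sub>R \<gamma> j s)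
      + clmul M c p (cov (X p) (grad M f c) p) s"
proof -
  \<comment> \<open>The covector in \<open>Ric_f_endo\<close> is given on coordinate fields, while
    Clifford multiplication needs it on the frame; this is its linear extension to all
    vectors.\<close>
  let ?r = "\<lambda>z. (\<Sum>i\<in>UNIV. ip M c p (Rm p (e i p) (X p) z) (e i p)) + ip M c p (cov (X p) (grad M f c) p) z"
  note lin = linear_Rm(2)[OF p]
  have r: "linear ?r"
    by (rule linearI) (simp_all add: linear_add[OF lin] linear_scale[OF lin] ip_simps sum.distrib
        sum_distrib_left algebra_simps)
  have "Ric_f M f c X (coord_field k) p = ?r (axis k 1)" for k
    unfolding Ric_f_def Hess_eq_cov_grad[OF f p] unfolding coord_field_def
    by (simp add: Ric_eq_frame[OF X _ p])
  then have "clmul M c p (Ric_f_endo M f c X p) s = (\<Sum>j\<in>UNIV. ?r (e j p) *\<^sub>R \<gamma> j s)"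
    by (simp only: Ric_f_endo_def clmul_sharp[OF p] linear_functional_inner[OF r])
  then show ?thesis
    by (simp add: clmul_sum[of p "cov _ _ _"] scaleR_add_left sum.distrib)
qed

section \<open>Assembling the commutator\<close>

lemma spin_nabla_spin_nabla:
  assumes "p \<in> cdom M c"
  shows "spin_nabla M c Y (spin_nabla M c X \<psi>) p = scov (Y p) (\<lambda>q. scov (X q) \<psi> q) p"
  unfolding spin_nabla_scov[OF assms, of Y]
  by (rule scov_cong[OF _ assms]) (rule spin_nabla_scov)

lemma tensor_commutator_eq:
  assumes f: "C2 f" and X: "dif X" and \<psi>: "C2 \<psi>" and p: "p \<in> cdom M c"
  shows "tensor_commutator M f c X \<psi> p = (1 / 2) *\<^sub>R clmul M c p (Ric_f_endo M f c X p) (\<psi> p)"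
proof -
  note \<psi>' = C2_dif[OF \<psi>]
  let ?R = "\<Sum>k\<in>UNIV. \<gamma> k (spin_rep (\<lambda>i j. curv_form (e k) X i j p) (\<psi> p))"
  let ?DX = "\<Sum>i\<in>UNIV. \<gamma> i (scov (X p) (\<lambda>q. scov (e i q) \<psi> q) p)"
  let ?g = "grad M f c"
  have form: "form_nabla M c (e i) (\<lambda>Y. spin_nabla M c Y \<psi>) X p
      = spin_rep (\<lambda>j k. curv_form (e i) X j k p) (\<psi> p) + scov (X p) (\<lambda>q. scov (e i q) \<psi> q) p
        - scov (cov (X p) (e i) p) \<psi> p" for i
  proof -
    \<comment> \<open>Torsion-freeness splits the correction term of \<open>form_nabla\<close> into
      the bracket, which completes the curvature, and the direction in which the frame
      rotates.\<close>
    have "lie_bracket M c (e i) X p = cov (e i p) X p - cov (X p) (e i) p"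
      by (simp add: lie_bracket_def cov_def Gam_sym[OF p, of "X p"])
    then have "scov (cov (e i p) X p) \<psi> p
        = scov (lie_bracket M c (e i) X p) \<psi> p + scov (cov (X p) (e i) p) \<psi> p"
      by (simp add: linear_diff[OF linear_scov[OF \<psi>' p]])
    then show ?thesis
      unfolding form_nabla_def spin_nabla_spin_nabla[OF p]
      using spin_curvature[OF \<psi> X dif_frame p, of i]
      by (simp add: spin_nabla_scov[OF p] nabla_cov algebra_simps)
  qed
  have "form_dirac_f M f c (\<lambda>Y. spin_nabla M c Y \<psi>) X p
      = ?R + ?DX - (\<Sum>i\<in>UNIV. clmul M c p (e i p) (scov (cov (X p) (e i) p) \<psi> p))
        - (1 / 2) *\<^sub>R clmul M c p (?g p) (scov (X p) \<psi> p)"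
    unfolding form_dirac_f_def form
    by (simp add: clmul_frame[OF p] \<gamma>_simps sum.distrib sum_subtractf spin_nabla_scov[OF p])
  moreover have "spin_nabla M c X (dirac_f M f c \<psi>) p
      = (\<Sum>i\<in>UNIV. clmul M c p (cov (X p) (e i) p) (scov (e i p) \<psi> p)) + ?DX
        - (1 / 2) *\<^sub>R (clmul M c p (cov (X p) ?g p) (\<psi> p) + clmul M c p (?g p) (scov (X p) \<psi> p))"
  proof -
    note dif = dif_clmul[OF dif_frame dif_scov[OF \<psi> dif_frame]] dif_clmul[OF dif_grad[OF f] \<psi>']
    have "spin_nabla M c X (dirac_f M f c \<psi>) p
      = scov (X p) (\<lambda>q. (\<Sum>i\<in>UNIV. clmul M c q (e i q) (scov (e i q) \<psi> q))
          - (1 / 2) *\<^sub>R clmul M c q (?g q) (\<psi> q)) p"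
      unfolding spin_nabla_scov[OF p]
      by (rule scov_cong[OF _ p]) (simp add: dirac_f_def dirac_scov)
    also have "\<dots> = (\<Sum>i\<in>UNIV. scov (X p) (\<lambda>q. clmul M c q (e i q) (scov (e i q) \<psi> q)) p)
          - (1 / 2) *\<^sub>R scov (X p) (\<lambda>q. clmul M c q (?g q) (\<psi> q)) p"
      by (simp add: scov_diff scov_sum scov_scaleR dif_sum dif_scaleR_const dif p)
    finally show ?thesis
      by (simp add: scov_clmul[OF dif_frame dif_scov[OF \<psi> dif_frame] p]
          scov_clmul[OF dif_grad[OF f] \<psi>' p] clmul_frame[OF p] sum.distrib)
  qed
  \<comment> \<open>\<open>?DX\<close> and the terms with \<open>?g p\<close> undifferentiated occur
    in both products; the two frame rotation sums agree by
    \<open>frame_rotation_cancels\<close>.\<close>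
  ultimately have "tensor_commutator M f c X \<psi> p = ?R + (1 / 2) *\<^sub>R clmul M c p (cov (X p) ?g p) (\<psi> p)"
    unfolding tensor_commutator_def frame_rotation_cancels[OF \<psi>' p]
    by (simp add: scaleR_add_right)
  then show ?thesis
    by (simp only: clmul_Ric_f_endo[OF f X p] clifford_trace_curvature[OF X p] scaleR_add_right)
qed

text \<open>The two commutators differ by derivatives of \<open>\<psi>\<close> in the directions of
  the covariant derivatives of \<open>X\<close> along the frame. Such a derivative is linear in its
  direction, so it vanishes where these directions do.\<close>

lemma op_commutator_eq_tensor_commutator:
  assumes "\<And>Y. nabla M c Y X p = 0" and \<psi>: "dif \<psi>" and p: "p \<in> cdom M c"
  shows "op_commutator M f c X \<psi> p = tensor_commutator M f c X \<psi> p"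
proof -
  have "spin_nabla M c (nabla M c Y X) \<psi> p = 0" for Y
    using linear_0[OF linear_scov[OF \<psi> p]] by (simp add: spin_nabla_scov[OF p] assms(1))
  then show ?thesis
    by (simp add: op_commutator_def tensor_commutator_def dirac_f_def dirac_def form_dirac_f_def form_nabla_def)
qed

end

theorem proposition2p15:
  fixes M :: "('c, 'm::{t2_space, second_countable_topology}, 'n::finite, 'k::finite) spin_manifold"
    and f :: "'m \<Rightarrow> real"
    and X :: "'c \<Rightarrow> 'm \<Rightarrow> real ^ 'n"
    and \<psi> :: "'c \<Rightarrow> 'm \<Rightarrow> complex ^ 'k"
  assumes "complete_riemannian_spin_manifold M"
    and "smooth_function M f"
    and "vector_field M X"
    and "spinor_field M \<psi>"
  shows "(\<forall>c. \<forall>p\<in>cdom M c.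
            tensor_commutator M f c (X c) (\<psi> c) p
            = (1 / 2) *\<^sub>R clmul M c p (Ric_f_endo M f c (X c) p) (\<psi> c p))
       \<and> (\<forall>c. \<forall>p\<in>cdom M c. (\<forall>Y. nabla M c Y (X c) p = 0) \<longrightarrow>
            op_commutator M f c (X c) (\<psi> c) p
            = (1 / 2) *\<^sub>R clmul M c p (Ric_f_endo M f c (X c) p) (\<psi> c p))"
proof -
  have main: "tensor_commutator M f c (X c) (\<psi> c) p
        = (1 / 2) *\<^sub>R clmul M c p (Ric_f_endo M f c (X c) p) (\<psi> c p)"
      "(\<forall>Y. nabla M c Y (X c) p = 0) \<Longrightarrow>
        op_commutator M f c (X c) (\<psi> c) p = tensor_commutator M f c (X c) (\<psi> c) p"
    if p: "p \<in> cdom M c" for c p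
  proof -
    interpret spin_chart M c
      by unfold_locales (rule assms(1))
    have f: "C2 f" and X: "dif (X c)" and \<psi>: "C2 (\<psi> c)"
      using assms(2-4) by (auto simp: smooth_function_def vector_field_def spinor_field_def
          intro!: C2_if_smooth C2_dif)
    show "tensor_commutator M f c (X c) (\<psi> c) p
        = (1 / 2) *\<^sub>R clmul M c p (Ric_f_endo M f c (X c) p) (\<psi> c p)"
      by (rule tensor_commutator_eq[OF f X \<psi> p])
    show "(\<forall>Y. nabla M c Y (X c) p = 0) \<Longrightarrow>
        op_commutator M f c (X c) (\<psi> c) p = tensor_commutator M f c (X c) (\<psi> c) p"
      by (rule op_commutator_eq_tensor_commutator[OF _ C2_dif[OF \<psi>] p]) simp
  qed
  then show ?thesis by simp
qed

end
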